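(* Let $s\ge 1$ be an integer, $F$ an arbitrary finite graph, and $\mathcal{F}=\{M_{s+1},F\}$. For sufficiently large $n$: (1) if $\beta'(\mathcal{F})=s+1$, then $\mathrm{Ex_{sp}}(n,\mathcal{F})\subseteq\mathrm{Ex}(n,\mathcal{F})$; (2) if $2\leq\beta'(\mathcal{F})\leq s$, then $\mathrm{Ex_{sp}}(n,\mathcal{F})\subseteq\mathcal{G}(\mathcal{F})$.
   Context: $M_{s+1}$ is a matching with $s+1$ edges. A graph is $\mathcal{F}$-free if it contains no member of $\mathcal{F}$ as a subgraph. $\mathrm{Ex}(m,\mathcal{F})$ is the set of $\mathcal{F}$-free $m$-vertex graphs with the maximum number of edges; for a graph $G_0$, $\mathrm{Ex}_{G_0}(n,\mathcal{F})$ is the set of $\mathcal{F}$-free $n$-vertex graphs containing $G_0$ as a subgraph with the maximum number of edges among such graphs. $\mathrm{Ex_{sp}}(n,\mathcal{F})$ is the set of $\mathcal{F}$-free $n$-vertex graphs of maximum adjacency spectral radius among $\mathcal{F}$-free $n$-vertex graphs. A covering of a graph is a vertex set meeting all edges; $\beta(G)$ / $\beta'(G)$ is the minimum size of a covering / independent covering ($\beta'(G)=+\infty$ if $G$ is not bipartite); $\beta(\mathcal{F})$, $\beta'(\mathcal{F})$ are minima over members. $\mathcal{M}(\mathcal{F})=\{F'[S]: F'\in\mathcal{F},\ S\text{ a covering of }F',\ |S|<\beta'(\mathcal{F})\}$; $\mathcal{H}(\mathcal{F})=\{K_{\beta'(\mathcal{F})}\}$ if $\beta'(\mathcal{F})=\beta(\mathcal{F})$,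 else $\mathcal{H}(\mathcal{F})=\mathcal{M}(\mathcal{F})$. $\mathcal{G}(\mathcal{F})=\bigcup\{\mathrm{Ex}_{T\vee I_{n+1-\beta'(\mathcal{F})}}(n,\mathcal{F}): T\in\mathrm{Ex}(\beta'(\mathcal{F})-1,\mathcal{H}(\mathcal{F}))\}$, where $\vee$ is the join and $I_m$ the edgeless graph on $m$ vertices. *)

theory Defs
  imports "Jordan_Normal_Form.Spectral_Radius" "HOL-Library.Extended_Nat"
begin

record 'a ugraph =
  verts :: "'a set"
  edges :: "'a set set"

definition fin_simple_graph :: "'a ugraph \<Rightarrow> bool" where
  "fin_simple_graph G \<longleftrightarrow>
     finite (verts G) \<and> (\<forall>e\<in>edges G. e \<subseteq> verts G \<and> card e = 2)"

(* H is isomorphic to a not necessarily induced subgraph of G. *)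
definition contains_subgraph :: "'a ugraph \<Rightarrow> 'b ugraph \<Rightarrow> bool" where
  "contains_subgraph G H \<longleftrightarrow>
     (\<exists>f. inj_on f (verts H) \<and> f ` verts H \<subseteq> verts G \<and> (\<forall>e\<in>edges H. f ` e \<in> edges G))"

definition induced_subgraph :: "'a ugraph \<Rightarrow> 'a set \<Rightarrow> 'a ugraph" where
  "induced_subgraph G S = \<lparr>verts = S, edges = {e \<in> edges G. e \<subseteq> S}\<rparr>"

definition complete_graph :: "nat \<Rightarrow> nat ugraph" where
  "complete_graph m = \<lparr>verts = {..<m}, edges = {e. e \<subseteq> {..<m} \<and> card e = 2}\<rparr>"

definition edgeless_graph :: "nat \<Rightarrow> nat ugraph" where
  "edgeless_graph m = \<lparr>verts = {..<m}, edges = {}\<rparr>"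

definition matching_graph :: "nat \<Rightarrow> nat ugraph" where
  "matching_graph m = \<lparr>verts = {..<2 * m}, edges = {{2 * i, 2 * i + 1} | i. i < m}\<rparr>"

definition graph_join :: "'a ugraph \<Rightarrow> 'b ugraph \<Rightarrow> ('a + 'b) ugraph" where
  "graph_join G H =
     \<lparr>verts = Inl ` verts G \<union> Inr ` verts H,
      edges = (\<lambda>e. Inl ` e) ` edges G \<union> (\<lambda>e. Inr ` e) ` edges H
        \<union> {{Inl u, Inr v} | u v. u \<in> verts G \<and> v \<in> verts H}\<rparr>"

definition covering :: "'a ugraph \<Rightarrow> 'a set \<Rightarrow> bool" where
  "covering G S \<longleftrightarrow> S \<subseteq> verts G \<and> (\<forall>e\<in>edges G. e \<inter> S \<noteq> {})"

definition independent_set :: "'a ugraph \<Rightarrow> 'a set \<Rightarrow> bool" where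
  "independent_set G S \<longleftrightarrow> S \<subseteq> verts G \<and> (\<forall>e\<in>edges G. \<not> e \<subseteq> S)"

definition cover_num :: "'a ugraph \<Rightarrow> enat" where
  "cover_num G = (INF S\<in>{S. covering G S}. enat (card S))"

(* A graph has an independent covering iff it is bipartite; the infimum of the empty set in
   enat is \<infinity>, the intended value for non-bipartite graphs. *)
definition indep_cover_num :: "'a ugraph \<Rightarrow> enat" where
  "indep_cover_num G = (INF S\<in>{S. covering G S \<and> independent_set G S}. enat (card S))"

definition fam_cover_num :: "'a ugraph set \<Rightarrow> enat" where
  "fam_cover_num Fs = (INF G\<in>Fs. cover_num G)"

definition fam_indep_cover_num :: "'a ugraph set \<Rightarrow> enat" where
  "fam_indep_cover_num Fs = (INF G\<in>Fs. indep_cover_num G)"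

(* Graphs on n vertices are represented by labelled graphs with vertex set {..<n}. *)
definition free_graphs :: "nat \<Rightarrow> 'b ugraph set \<Rightarrow> nat ugraph set" where
  "free_graphs n Fs =
     {G. fin_simple_graph G \<and> verts G = {..<n} \<and> (\<forall>H\<in>Fs. \<not> contains_subgraph G H)}"

definition edge_extremal :: "nat \<Rightarrow> 'b ugraph set \<Rightarrow> nat ugraph set" where
  "edge_extremal n Fs =
     {G \<in> free_graphs n Fs. \<forall>G'\<in>free_graphs n Fs. card (edges G') \<le> card (edges G)}"

definition edge_extremal_containing ::
    "'a ugraph \<Rightarrow> nat \<Rightarrow> 'b ugraph set \<Rightarrow> nat ugraph set" where
  "edge_extremal_containing G0 n Fs =
     {G \<in> free_graphs n Fs. contains_subgraph G G0 \<and>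
        (\<forall>G'\<in>free_graphs n Fs. contains_subgraph G' G0 \<longrightarrow> card (edges G') \<le> card (edges G))}"

(* Intended for graphs with vertex set {..<n}. *)
definition adjacency_matrix :: "nat \<Rightarrow> nat ugraph \<Rightarrow> complex mat" where
  "adjacency_matrix n G = mat n n (\<lambda>(i, j). if {i, j} \<in> edges G then 1 else 0)"

definition spectral_extremal :: "nat \<Rightarrow> 'b ugraph set \<Rightarrow> nat ugraph set" where
  "spectral_extremal n Fs =
     {G \<in> free_graphs n Fs. \<forall>G'\<in>free_graphs n Fs.
        spectral_radius (adjacency_matrix n G') \<le> spectral_radius (adjacency_matrix n G)}"

definition covering_family :: "'a ugraph set \<Rightarrow> 'a ugraph set" where
  "covering_family Fs =
     {induced_subgraph F S | F S.
        F \<in> Fs \<and> covering F S \<and> enat (card S) < fam_indep_cover_num Fs}"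

definition core_family :: "nat ugraph set \<Rightarrow> nat ugraph set" where
  "core_family Fs =
     (if fam_indep_cover_num Fs = fam_cover_num Fs
      then {complete_graph (the_enat (fam_indep_cover_num Fs))}
      else covering_family Fs)"

(* Meaningful when fam_indep_cover_num Fs is finite and between 1 and n + 1. *)
definition join_extremal :: "nat \<Rightarrow> nat ugraph set \<Rightarrow> nat ugraph set" where
  "join_extremal n Fs =
     (let b = the_enat (fam_indep_cover_num Fs) in
      \<Union>T\<in>edge_extremal (b - 1) (core_family Fs).
        edge_extremal_containing (graph_join T (edgeless_graph (n + 1 - b))) n Fs)"

end

theory Submission
  imports Defs "HOL-Analysis.Function_Topology" "HOL-Real_Asymp.Real_Asymp"
begin

text \<open>Let \<open>k = \<beta>'(\<F>) - 1 \<ge> 1\<close>. Since \<open>K\<^bsub>k,n-k\<^esub>\<close> is \<open>\<F>\<close>-free, an extremal graph has spectral radius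
  \<open>\<rho> \<ge> sqrt (k (n - k))\<close>. It has a vertex cover of size at most \<open>2 s\<close>, and no \<open>k + 1\<close> vertices have many
  common neighbours, as \<open>\<F>\<close> has a member with an independent covering of size \<open>k + 1\<close>. Hence all but
  boundedly many vertices outside the cover have at most \<open>k\<close> neighbours, and comparing \<open>\<rho>\<^sup>2 x\<close> with
  two-step walks forces the Perron vector \<open>x\<close> (with maximum 1) to be close to 1 on exactly \<open>k\<close> vertices
  \<open>S\<close> and \<open>O(1 / \<rho>)\<close> elsewhere. Replacing the neighbourhood of every vertex outside \<open>S\<close> that misses a
  part of \<open>S\<close> by \<open>S\<close> itself keeps the graph \<open>\<F>\<close>-free and increases the quadratic form at \<open>x\<close>, so \<open>S\<close> is
  completely joined to the rest. The weights of \<open>x\<close> are nearly constant on \<open>S\<close> and nearly constant off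
  \<open>S\<close>, and the former dominate; so the quadratic form at \<open>x\<close> shows that \<open>G[S]\<close> has the maximum number of
  edges and that, for this \<open>G[S]\<close>, so has \<open>G - S\<close>.\<close>

section \<open>The spectral radius of a symmetric nonnegative matrix\<close>

text \<open>Extremality enters through one inequality only: every free \<open>G'\<close> satisfies
  \<open>quad_form n (adj G') x \<le> quad_form n (adj G) x\<close>, because x attains the Rayleigh
  quotient \<rho> of G while no free graph exceeds \<rho>. The price is that G is not known to be
  connected: x may vanish somewhere, a gain may fail to be strict, and the equality case of the
  Rayleigh bound has to settle this. The forbidden matching supplies a cover of bounded size, hence
  a bound independent of n on the number of edges outside the hubs. An edge inside the core weighs
  nearly 1 and an edge outside it only O(1/\<rho>^2); this is why core edges take precedence, and
  why part (2) optimises T alone and the remaining edges for a fixed T. Part (1) asks for more,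
  since its competitors need not contain a completely joined set; it rests on a separate count for k
  = s.\<close>

definition quad_form :: "nat \<Rightarrow> (nat \<Rightarrow> nat \<Rightarrow> real) \<Rightarrow> (nat \<Rightarrow> real) \<Rightarrow> real" where
  "quad_form n a x = (\<Sum>i<n. \<Sum>j<n. a i j * x i * x j)"

text \<open>Near 0 the linear term beats the quadratic one. This is the first-order condition at a
  maximum, applied below along a coordinate direction.\<close>

lemma linear_coeff_zero_if_quadratic_nonpos:
  fixes p q :: real
  assumes "\<And>t. t\<^sup>2 * p + t * q \<le> 0"
  shows "q = 0"
proof (rule ccontr)
  assume q: "q \<noteq> 0"
  \<comment> \<open>With \<open>t = r * q\<close> the expression factors as
    \<open>(r * q^2) * (r * p + 1)\<close>, and this r makes the second factor positive.\<close>
  define r where "r = 1 / (\<bar>p\<bar> + 1)"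
  have r: "r > 0" "r * \<bar>p\<bar> < 1"
    by (auto simp: r_def field_simps)
  have "(r * q)\<^sup>2 * p + (r * q) * q \<le> 0" by (rule assms)
  then have "(r * q\<^sup>2) * (r * p + 1) \<le> 0"
    by (simp add: power2_eq_square algebra_simps)
  moreover have "r * p + 1 > 0"
  proof -
    have "r * - p \<le> r * \<bar>p\<bar>" using r(1) by (intro mult_left_mono) auto
    then show ?thesis using r(2) by simp
  qed
  moreover have "r * q\<^sup>2 > 0" using r q by simp
  ultimately show False using mult_pos_pos[of "r * q\<^sup>2" "r * p + 1"] by linarith
qed

text \<open>The function \<open>quad_form n a y - r * (\<Sum>i<n. (y i)\<^sup>2)\<close> is
  nonpositive and vanishes at x, so its derivative in the direction of coordinate i vanishes there.
  It serves twice: to turn a maximiser into an eigenvector, and for the equality case in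
  \<open>S_full\<close>.\<close>

lemma rayleigh_equality_imp_eigenvector:
  assumes sym: "\<And>i j. i < n \<Longrightarrow> j < n \<Longrightarrow> a i j = a j i"
    and le: "\<And>y. quad_form n a y \<le> r * (\<Sum>i<n. (y i)\<^sup>2)"
    and eq: "quad_form n a x = r * (\<Sum>i<n. (x i)\<^sup>2)"
    and i: "i < n"
  shows "(\<Sum>j<n. a i j * x j) = r * x i"
proof -
  define d where "d j = (if j = i then 1 else 0 :: real)" for j
  have dq: "quad_form n a (\<lambda>j. x j + t * d j)
      = quad_form n a x + 2 * t * (\<Sum>j<n. a i j * x j) + t\<^sup>2 * a i i" for t
  proof -
    have "quad_form n a (\<lambda>j. x j + t * d j) = (\<Sum>p<n. \<Sum>j<n. a p j * x p * x j +
        t * (a p j * x p * d j) + t * (d p * (a p j * x j)) + t\<^sup>2 * (d p * (a p j * d j)))"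
      unfolding quad_form_def by (intro sum.cong refl) (simp add: algebra_simps power2_eq_square)
    also have "\<dots> = quad_form n a x + t * (\<Sum>p<n. \<Sum>j<n. a p j * x p * d j)
       + t * (\<Sum>p<n. d p * (\<Sum>j<n. a p j * x j)) + t\<^sup>2 * (\<Sum>p<n. d p * (\<Sum>j<n. a p j * d j))"
      by (simp add: quad_form_def sum.distrib sum_distrib_left)
    also have "(\<Sum>p<n. d p * (\<Sum>j<n. a p j * x j)) = (\<Sum>j<n. a i j * x j)"
      using i by (simp add: d_def if_distrib[of "\<lambda>u. u * _"] sum.delta cong: if_cong)
    also have "(\<Sum>p<n. d p * (\<Sum>j<n. a p j * d j)) = a i i"
      using i by (simp add: d_def if_distrib[of "\<lambda>u. u * _"] if_distrib[of "\<lambda>u. _ * u"] sum.delta cong: if_cong)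
    also have "(\<Sum>p<n. \<Sum>j<n. a p j * x p * d j) = (\<Sum>p<n. a p i * x p)"
      using i by (simp add: d_def if_distrib[of "\<lambda>u. u * _"] if_distrib[of "\<lambda>u. _ * u"] sum.delta cong: if_cong)
    also have "\<dots> = (\<Sum>p<n. a i p * x p)" using sym i by (intro sum.cong) auto
    finally show ?thesis by (simp add: algebra_simps)
  qed
  have dn: "(\<Sum>j<n. (x j + t * d j)\<^sup>2) = (\<Sum>j<n. (x j)\<^sup>2) + 2 * t * x i + t\<^sup>2" for t
  proof -
    have "(\<Sum>j<n. (x j + t * d j)\<^sup>2) = (\<Sum>j<n. (x j)\<^sup>2 + (2 * t) * (d j * x j) + t\<^sup>2 * d j)"
      by (intro sum.cong refl) (auto simp: d_def algebra_simps power2_eq_square)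
    also have "\<dots> = (\<Sum>j<n. (x j)\<^sup>2) + (2 * t) * (\<Sum>j<n. d j * x j) + t\<^sup>2 * (\<Sum>j<n. d j)"
      by (simp add: sum.distrib sum_distrib_left)
    also have "(\<Sum>j<n. d j) = 1" using i by (simp add: d_def)
    also have "(\<Sum>j<n. d j * x j) = x i"
      using i by (simp add: d_def if_distrib[of "\<lambda>u. u * _"] sum.delta cong: if_cong)
    finally show ?thesis by simp
  qed
  have "t\<^sup>2 * (a i i - r) + t * (2 * ((\<Sum>j<n. a i j * x j) - r * x i)) \<le> 0" for t
    using le[of "\<lambda>j. x j + t * d j"] unfolding dq dn eq by (simp add: algebra_simps)
  from linear_coeff_zero_if_quadratic_nonpos[OF this] show ?thesis by simp
qed

lemma quad_form_attains_sup:
  assumes n: "n > 0"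
    and nonneg: "\<And>i j. i < n \<Longrightarrow> j < n \<Longrightarrow> a i j \<ge> 0"
  obtains x r where "\<And>i. x i \<ge> (0::real)" "(\<Sum>i<n. (x i)\<^sup>2) = 1" "quad_form n a x = r"
    "\<And>y. quad_form n a y \<le> r * (\<Sum>i<n. (y i)\<^sup>2)"
proof -
  \<comment> \<open>Vectors are functions on all naturals. Fixing the coordinates from n on to 0
    makes the box compact by Tychonoff's theorem, and the interval {0..1} makes every maximiser
    nonnegative.\<close>
  define B where "B = (\<Pi>\<^sub>E i\<in>(UNIV::nat set). (if i < n then {0..1::real} else {0}))"
  define K where "K = {x. (\<Sum>i<n. (x i)\<^sup>2) = 1} \<inter> B"
  have "compactin (product_topology (\<lambda>i. euclidean) UNIV) B"
    unfolding B_def compactin_PiE by auto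
  then have cB: "compact B" by (simp add: euclidean_product_topology)
  have cont: "continuous_on UNIV (\<lambda>x::nat\<Rightarrow>real. x i)" for i by simp
  have "closed {x::nat\<Rightarrow>real. (\<Sum>i<n. (x i)\<^sup>2) = 1}"
    by (intro closed_Collect_eq continuous_intros cont)
  then have cK: "compact K" unfolding K_def using cB by (rule closed_Int_compact)
  have "(\<lambda>i. if i = 0 then 1 else 0 :: real) \<in> K"
    using n by (auto simp: K_def B_def PiE_def if_distrib[of "\<lambda>u. u\<^sup>2"] sum.delta cong: if_cong)
  then have ne: "K \<noteq> {}" by auto
  have "continuous_on K (quad_form n a)"
    unfolding quad_form_def
    by (intro continuous_intros continuous_on_subset[OF cont]) auto
  from continuous_attains_sup[OF cK ne this] obtain x where
    x: "x \<in> K" and max: "\<And>y. y \<in> K \<Longrightarrow> quad_form n a y \<le> quad_form n a x" by auto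
  have bnd: "quad_form n a y \<le> quad_form n a x * (\<Sum>i<n. (y i)\<^sup>2)" for y
  proof (cases "(\<Sum>i<n. (y i)\<^sup>2) = 0")
    case True
    then have "\<forall>i\<in>{..<n}. (y i)\<^sup>2 = 0" by (subst (asm) sum_nonneg_eq_0_iff) auto
    then have "quad_form n a y = 0" by (auto simp: quad_form_def)
    then show ?thesis using True by simp
  next
    case False
    define N where "N = (\<Sum>i<n. (y i)\<^sup>2)"
    have N: "N > 0" using False sum_nonneg[of "{..<n}" "\<lambda>i. (y i)\<^sup>2"] unfolding N_def by simp
    \<comment> \<open>Absolute values do not decrease the form, because the entries of a are
      nonnegative; so the maximum over the nonnegative box bounds all y.\<close>
    define z where "z i = (if i < n then \<bar>y i\<bar> / sqrt N else 0)" for i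
    have "(\<Sum>i<n. (z i)\<^sup>2) = (\<Sum>i<n. (y i)\<^sup>2 / N)"
      using N by (intro sum.cong) (auto simp: z_def power_divide)
    also have "\<dots> = 1" using N by (simp add: sum_divide_distrib[symmetric] N_def[symmetric])
    finally have zn: "(\<Sum>i<n. (z i)\<^sup>2) = 1" .
    have "z i \<le> 1" if "i < n" for i
    proof -
      have "(z i)\<^sup>2 \<le> (\<Sum>i<n. (z i)\<^sup>2)" using that by (intro member_le_sum) auto
      then have "(z i)\<^sup>2 \<le> 1\<^sup>2" using zn by simp
      then show ?thesis by (rule power2_le_imp_le) simp
    qed
    then have "z \<in> B" using N by (auto simp: B_def PiE_def z_def)
    then have "z \<in> K" using zn by (simp add: K_def)
    then have "quad_form n a z \<le> quad_form n a x" by (rule max)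
    moreover have "quad_form n a y \<le> N * quad_form n a z"
    proof -
      have "a i j * y i * y j \<le> N * (a i j * z i * z j)" if "i < n" "j < n" for i j
      proof -
        have "N * (a i j * z i * z j) = a i j * (\<bar>y i\<bar> * \<bar>y j\<bar>)"
          using N that by (simp add: z_def field_simps)
        moreover have "a i j * (y i * y j) \<le> a i j * (\<bar>y i\<bar> * \<bar>y j\<bar>)"
          using nonneg[OF that] by (intro mult_left_mono) (auto simp flip: abs_mult)
        ultimately show ?thesis unfolding mult.assoc by linarith
      qed
      then show ?thesis unfolding quad_form_def sum_distrib_left by (intro sum_mono) auto
    qed
    ultimately show ?thesis using N mult_left_mono[of "quad_form n a z" "quad_form n a x" N]
      unfolding N_def[symmetric] mult.commute[of _ N] by linarith
  qed
  show thesis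
  proof (rule that[OF _ _ refl bnd])
    show "x i \<ge> 0" for i using x by (auto simp: K_def B_def PiE_def Pi_def split: if_splits)
    show "(\<Sum>i<n. (x i)\<^sup>2) = 1" using x by (simp add: K_def)
  qed
qed

text \<open>The maximal Rayleigh quotient q is an eigenvalue, so it is at most the spectral radius.
  Conversely, the moduli of the entries of a complex eigenvector for \<mu> form a real vector of
  Rayleigh quotient at least |\<mu>|, by the triangle inequality. No spectral decomposition is
  involved.\<close>

lemma spectral_radius_symmetric_nonneg:
  assumes n: "n > 0"
    and nonneg: "\<And>i j. i < n \<Longrightarrow> j < n \<Longrightarrow> a i j \<ge> (0::real)"
    and sym: "\<And>i j. i < n \<Longrightarrow> j < n \<Longrightarrow> a i j = a j i"
    and r: "r = spectral_radius (mat n n (\<lambda>(i, j). complex_of_real (a i j)))"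
  shows "quad_form n a y \<le> r * (\<Sum>i<n. (y i)\<^sup>2)"
    and "\<exists>x. (\<forall>i. x i \<ge> 0) \<and> (\<Sum>i<n. (x i)\<^sup>2) = 1 \<and> (\<forall>i<n. (\<Sum>j<n. a i j * x j) = r * x i)"
proof -
  define A where "A = mat n n (\<lambda>(i, j). complex_of_real (a i j))"
  have A: "A \<in> carrier_mat n n" by (simp add: A_def)
  obtain x q where x: "\<And>i. x i \<ge> (0::real)" "(\<Sum>i<n. (x i)\<^sup>2) = 1" "quad_form n a x = q"
    and max: "\<And>y. quad_form n a y \<le> q * (\<Sum>i<n. (y i)\<^sup>2)"
    using quad_form_attains_sup[of n a, OF n nonneg] by blast
  have eig: "(\<Sum>j<n. a i j * x j) = q * x i" if "i < n" for i
    by (rule rayleigh_equality_imp_eigenvector[OF sym max _ that]) (use x in auto)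
  have q0: "q \<ge> 0"
    using x(1) nonneg unfolding x(3)[symmetric] quad_form_def by (intro sum_nonneg) auto
  have mv: "(A *\<^sub>v v) $ i = (\<Sum>j<n. complex_of_real (a i j) * v $ j)"
    if "i < n" "v \<in> carrier_vec n" for i v
    using that by (auto simp: A_def scalar_prod_def lessThan_atLeast0)
  have "eigenvalue A (complex_of_real q)"
  proof -
    define v where "v = vec n (\<lambda>i. complex_of_real (x i))"
    have v: "v \<in> carrier_vec n" by (simp add: v_def)
    have "A *\<^sub>v v = complex_of_real q \<cdot>\<^sub>v v"
    proof (rule eq_vecI)
      show "dim_vec (A *\<^sub>v v) = dim_vec (complex_of_real q \<cdot>\<^sub>v v)" using A v by simp
      fix i assume "i < dim_vec (complex_of_real q \<cdot>\<^sub>v v)"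
      then have i: "i < n" using v by simp
      have "(A *\<^sub>v v) $ i = complex_of_real (\<Sum>j<n. a i j * x j)"
        unfolding mv[OF i v] by (simp add: v_def)
      then show "(A *\<^sub>v v) $ i = (complex_of_real q \<cdot>\<^sub>v v) $ i"
        using i by (simp add: eig v_def)
    qed
    moreover have "v \<noteq> 0\<^sub>v n"
    proof
      assume "v = 0\<^sub>v n"
      then have "x i = 0" if "i < n" for i using that by (metis v_def index_vec index_zero_vec(1) of_real_eq_0_iff)
      then show False using x(2) by simp
    qed
    ultimately show ?thesis using A v unfolding eigenvalue_def eigenvector_def by auto
  qed
  then have "norm (complex_of_real q) \<le> r"
    unfolding r A_def[symmetric] spectrum_def
    by (intro spectral_radius_mem_max(2)[OF A n] imageI) (simp add: spectrum_def)
  then have "q \<le> r" by simp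
  moreover have "r \<le> q"
  proof -
    obtain \<mu> where \<mu>: "eigenvalue A \<mu>" "r = norm \<mu>"
      using spectral_radius_mem_max(1)[OF A n] unfolding r A_def[symmetric] by (auto simp: spectrum_def)
    then obtain v where v: "v \<in> carrier_vec n" "v \<noteq> 0\<^sub>v n" "A *\<^sub>v v = \<mu> \<cdot>\<^sub>v v"
      using A unfolding eigenvalue_def eigenvector_def by auto
    define y where "y i = norm (v $ i)" for i
    have "norm \<mu> * (y i)\<^sup>2 \<le> (\<Sum>j<n. a i j * y i * y j)" if i: "i < n" for i
    proof -
      have "(\<Sum>j<n. complex_of_real (a i j) * v $ j) = \<mu> * v $ i"
        using mv[OF i v(1)] v i by simp
      then have "norm \<mu> * y i = norm (\<Sum>j<n. complex_of_real (a i j) * v $ j)"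
        by (simp add: y_def norm_mult)
      also have "\<dots> \<le> (\<Sum>j<n. norm (complex_of_real (a i j) * v $ j))" by (rule norm_sum)
      also have "\<dots> = (\<Sum>j<n. a i j * y j)"
        using nonneg i by (intro sum.cong) (auto simp: norm_mult y_def)
      finally have "y i * (norm \<mu> * y i) \<le> y i * (\<Sum>j<n. a i j * y j)"
        by (intro mult_left_mono) (auto simp: y_def)
      then show ?thesis by (simp add: power2_eq_square sum_distrib_left mult_ac)
    qed
    then have "norm \<mu> * (\<Sum>i<n. (y i)\<^sup>2) \<le> quad_form n a y"
      unfolding quad_form_def sum_distrib_left by (intro sum_mono) auto
    also have "\<dots> \<le> q * (\<Sum>i<n. (y i)\<^sup>2)" by (rule max)
    finally have le: "norm \<mu> * (\<Sum>i<n. (y i)\<^sup>2) \<le> q * (\<Sum>i<n. (y i)\<^sup>2)" .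
    obtain i where i: "i < n" "v $ i \<noteq> 0" using v by (metis carrier_vecD eq_vecI index_zero_vec)
    have "(y i)\<^sup>2 \<le> (\<Sum>i<n. (y i)\<^sup>2)" using i by (intro member_le_sum) auto
    moreover have "(y i)\<^sup>2 > 0" using i by (simp add: y_def)
    ultimately have "(\<Sum>i<n. (y i)\<^sup>2) > 0" by linarith
    with le \<mu>(2) show ?thesis by simp
  qed
  ultimately have rq: "r = q" by simp
  show "quad_form n a y \<le> r * (\<Sum>i<n. (y i)\<^sup>2)" using max rq by simp
  show "\<exists>x. (\<forall>i. x i \<ge> 0) \<and> (\<Sum>i<n. (x i)\<^sup>2) = 1 \<and> (\<forall>i<n. (\<Sum>j<n. a i j * x j) = r * x i)"
    using x eig rq by auto
qed

section \<open>Weighted adjacency sums\<close>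

definition adj :: "nat ugraph \<Rightarrow> nat \<Rightarrow> nat \<Rightarrow> real" where
  "adj G i j = (if {i, j} \<in> edges G then 1 else 0)"

definition common_nbrs :: "'a ugraph \<Rightarrow> 'a set \<Rightarrow> 'a set" where
  "common_nbrs G L = {v \<in> verts G. \<forall>w\<in>L. {w, v} \<in> edges G}"

definition rejoin :: "'a ugraph \<Rightarrow> 'a set \<Rightarrow> 'a set \<Rightarrow> 'a ugraph" where
  "rejoin G S R =
     \<lparr>verts = verts G, edges = {e \<in> edges G. e \<inter> R = {}} \<union> {{w, v} | w v. w \<in> S \<and> v \<in> R}\<rparr>"

definition block_form ::
    "(nat \<Rightarrow> nat \<Rightarrow> real) \<Rightarrow> nat set \<Rightarrow> nat set \<Rightarrow> (nat \<Rightarrow> real) \<Rightarrow> real" where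
  "block_form a X Y x = (\<Sum>i\<in>X. \<Sum>j\<in>Y. a i j * x i * x j)"

lemma adj_sym: "adj G i j = adj G j i"
  by (simp add: adj_def insert_commute)

lemma adj_nonneg: "adj G i j \<ge> 0" and adj_le_1: "adj G i j \<le> 1"
  by (simp_all add: adj_def)

lemma simple_graph_no_loop: "fin_simple_graph G \<Longrightarrow> {v, v} \<notin> edges G"
  by (auto simp: fin_simple_graph_def)

lemma simple_graph_edge_verts: "fin_simple_graph G \<Longrightarrow> {u, v} \<in> edges G \<Longrightarrow> u \<in> verts G \<and> v \<in> verts G"
  by (auto simp: fin_simple_graph_def)

lemma quad_form_eq_block_form: "quad_form n a x = block_form a {..<n} {..<n} x"
  by (simp add: quad_form_def block_form_def)

lemma block_form_split:
  assumes "S \<subseteq> {..<n}" and sym: "\<And>i j. a i j = a j i"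
  shows "block_form a {..<n} {..<n} x =
    block_form a S S x + 2 * block_form a S ({..<n} - S) x
      + block_form a ({..<n} - S) ({..<n} - S) x"
proof -
  have fin: "finite S" using assms(1) finite_subset by blast
  have sp: "(\<Sum>i<n. f i) = (\<Sum>i\<in>S. f i) + (\<Sum>i\<in>{..<n} - S. f i)" for f :: "nat \<Rightarrow> real"
    using sum.subset_diff[OF assms(1), of f] by simp
  have "block_form a ({..<n} - S) S x = block_form a S ({..<n} - S) x"
    unfolding block_form_def by (subst sum.swap) (simp add: sym[of _ "_::nat"] mult_ac)
  then show ?thesis
    unfolding block_form_def by (simp add: sp sum.distrib)
qed

text \<open>The constants of the stability argument: \<open>perturb\<close> bounds the contribution of the cover and of
  the exceptional vertices to two steps of a walk, \<open>tail\<close> bounds the entries of the Perron vector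
  (scaled to maximum 1) outside the \<open>k\<close> hubs.\<close>

definition perturb :: "nat \<Rightarrow> nat \<Rightarrow> real \<Rightarrow> real" where
  "perturb c M t = real c * t + 2 ^ c * real M * real c"

definition tail :: "nat \<Rightarrow> nat \<Rightarrow> nat \<Rightarrow> real \<Rightarrow> real" where
  "tail k c M t =
     (perturb c M t + 2 * real k * real (k + 1) * (real k ^ 2 + perturb c M t)) / t ^ 2"

text \<open>After the two lower bounds on t, the conjuncts serve in this order: k + 1 hubs are
  impossible; at least P vertices see all hubs; rejoining gains weight; an extra core edge outweighs
  everything outside the core; an extra edge outside the core outweighs the variation of the entries
  there.\<close>

definition large :: "nat \<Rightarrow> nat \<Rightarrow> nat \<Rightarrow> nat \<Rightarrow> real \<Rightarrow> bool" where
  "large k c M P t \<longleftrightarrow>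
     t > real k \<and> t > real M \<and>
     real k * real M + real (k + 1) * (real k ^ 2 + perturb c M t) + perturb c M t \<le> t ^ 2 / 2 \<and>
     real k * (real P + 1 + real c + 2 ^ c * real M
       + 2 * real (k + 1) * (real k ^ 2 + perturb c M t)) + perturb c M t \<le> t ^ 2 \<and>
     (2 * real c + 2 ^ c * real M) * tail k c M t < 1 / 2 \<and>
     (1 - real k / t) ^ 2 - real k ^ 2 * (1 - (1 - real k / t) ^ 2)
       - 2 * real c * real M * (tail k c M t) ^ 2 > 0 \<and>
     (t - real M) ^ 2 > 2 * real c * real M * (t ^ 2 - (t - real M) ^ 2)"

lemma tail_nonneg: "t \<ge> 0 \<Longrightarrow> tail k c M t \<ge> 0"
  by (simp add: tail_def perturb_def)

text \<open>\<open>perturb\<close> is linear in t, so its quotient by t^2 tends to 0 and so does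
  \<open>tail\<close>. Each conjunct compares such vanishing quantities with a positive limit, in
  some cases after division by t^2.\<close>

lemma eventually_large: "eventually (large k c M P) at_top"
proof -
  have p: "((\<lambda>t. perturb c M t / t ^ 2) \<longlongrightarrow> 0) at_top"
  proof -
    have "((\<lambda>t::real. real c * (1 / t) + 2 ^ c * real M * real c * (1 / t ^ 2)) \<longlongrightarrow> real c * 0 + 2 ^ c * real M * real c * 0) at_top"
      by (intro tendsto_intros) real_asymp+
    moreover have "eventually (\<lambda>t. real c * (1 / t) + 2 ^ c * real M * real c * (1 / t ^ 2) = perturb c M t / t ^ 2) at_top"
      using eventually_gt_at_top[of 0]
      by eventually_elim (simp add: perturb_def field_simps power2_eq_square)
    ultimately show ?thesis using Lim_transform_eventually by force
  qed
  have i: "((\<lambda>t. a / t ^ 2) \<longlongrightarrow> 0) at_top" for a :: real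
    using tendsto_mult_right_zero[of "\<lambda>t::real. 1 / t ^ 2" at_top a] by (simp, real_asymp)
  have i1: "((\<lambda>t. a / t) \<longlongrightarrow> 0) at_top" for a :: real
    using tendsto_mult_right_zero[of "\<lambda>t::real. 1 / t" at_top a] by (simp, real_asymp)
  have le: "eventually (\<lambda>t. a + b * perturb c M t \<le> d * t ^ 2) at_top" if "d > 0" for a b d :: real
  proof -
    have "((\<lambda>t. a / t ^ 2 + b * (perturb c M t / t ^ 2)) \<longlongrightarrow> 0 + b * 0) at_top"
      by (intro tendsto_intros i p)
    then have "eventually (\<lambda>t. a / t ^ 2 + b * (perturb c M t / t ^ 2) < d) at_top"
      using that by (intro order_tendstoD) auto
    then show ?thesis using eventually_gt_at_top[of 0]
      by eventually_elim (simp add: field_simps)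
  qed
  have t: "(tail k c M \<longlongrightarrow> 0) at_top"
  proof -
    have "((\<lambda>t. perturb c M t / t ^ 2 + 2 * real k * real (k + 1) * (real k ^ 2 / t ^ 2 + perturb c M t / t ^ 2)) \<longlongrightarrow> 0 + 2 * real k * real (k + 1) * (0 + 0)) at_top"
      by (intro tendsto_intros i p)
    then show ?thesis unfolding tail_def[abs_def] add_divide_distrib times_divide_eq_right[symmetric] by simp
  qed
  have q: "((\<lambda>t. (1 - real k / t) ^ 2) \<longlongrightarrow> 1) at_top"
    using tendsto_power[OF tendsto_diff[OF tendsto_const[of 1] i1[of "real k"]], of 2] by simp
  have q': "((\<lambda>t. (1 - real M / t) ^ 2) \<longlongrightarrow> 1) at_top"
    using tendsto_power[OF tendsto_diff[OF tendsto_const[of 1] i1[of "real M"]], of 2] by simp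
  have 1: "eventually (\<lambda>t. real k * real M + real (k + 1) * (real k ^ 2 + perturb c M t) + perturb c M t \<le> t ^ 2 / 2) at_top"
    using le[of "1/2" "real k * real M + real (k + 1) * real k ^ 2" "real (k + 1) + 1"]
    by (simp add: algebra_simps)
  have 2: "eventually (\<lambda>t. real k * (real P + 1 + real c + 2 ^ c * real M
       + 2 * real (k + 1) * (real k ^ 2 + perturb c M t)) + perturb c M t \<le> t ^ 2) at_top"
    using le[of 1 "real k * (real P + 1 + real c + 2 ^ c * real M + 2 * real (k + 1) * real k ^ 2)"
       "2 * real k * real (k + 1) + 1"]
    by (simp add: algebra_simps)
  have "((\<lambda>t. (2 * real c + 2 ^ c * real M) * tail k c M t) \<longlongrightarrow> (2 * real c + 2 ^ c * real M) * 0) at_top"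
    by (intro tendsto_intros t)
  then have 3: "eventually (\<lambda>t. (2 * real c + 2 ^ c * real M) * tail k c M t < 1 / 2) at_top"
    by (intro order_tendstoD) auto
  have "((\<lambda>t. (1 - real k / t) ^ 2 - real k ^ 2 * (1 - (1 - real k / t) ^ 2)
       - 2 * real c * real M * (tail k c M t) ^ 2) \<longlongrightarrow> 1 - real k ^ 2 * (1 - 1) - 2 * real c * real M * 0 ^ 2) at_top"
    by (intro tendsto_intros t q)
  then have 4: "eventually (\<lambda>t. (1 - real k / t) ^ 2 - real k ^ 2 * (1 - (1 - real k / t) ^ 2)
       - 2 * real c * real M * (tail k c M t) ^ 2 > 0) at_top"
    by (intro order_tendstoD) auto
  have "((\<lambda>t. (1 - real M / t) ^ 2 - 2 * real c * real M * (1 - (1 - real M / t) ^ 2)) \<longlongrightarrow> 1 - 2 * real c * real M * (1 - 1)) at_top"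
    by (intro tendsto_intros q')
  then have "eventually (\<lambda>t. (1 - real M / t) ^ 2 - 2 * real c * real M * (1 - (1 - real M / t) ^ 2) > 0) at_top"
    by (intro order_tendstoD) auto
  then have 5: "eventually (\<lambda>t. (t - real M) ^ 2 > 2 * real c * real M * (t ^ 2 - (t - real M) ^ 2)) at_top"
    using eventually_gt_at_top[of 0]
  proof eventually_elim
    case (elim t)
    have e: "(t - real M) ^ 2 = t ^ 2 * (1 - real M / t) ^ 2"
      using elim by (simp add: power_mult_distrib[symmetric] algebra_simps)
    have "0 < t ^ 2 * ((1 - real M / t) ^ 2 - 2 * real c * real M * (1 - (1 - real M / t) ^ 2))"
      using elim by (intro mult_pos_pos) auto
    also have "\<dots> = (t - real M) ^ 2 - 2 * real c * real M * (t ^ 2 - (t - real M) ^ 2)"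
      unfolding e by (simp add: algebra_simps)
    finally show ?case by simp
  qed
  show ?thesis
    using 1 2 3 4 5 eventually_gt_at_top[of "real k"] eventually_gt_at_top[of "real M"]
    by eventually_elim (simp only: large_def)
qed

text \<open>Ordered pairs match the double sums of the quadratic form; each edge of a simple graph
  inside X counts twice.\<close>

definition adj_pairs :: "'a ugraph \<Rightarrow> 'a set \<Rightarrow> ('a \<times> 'a) set" where
  "adj_pairs G X = {(i, j). i \<in> X \<and> j \<in> X \<and> {i, j} \<in> edges G}"

definition fully_joined :: "'a ugraph \<Rightarrow> 'a set \<Rightarrow> bool" where
  "fully_joined G S \<longleftrightarrow> (\<forall>w\<in>S. \<forall>v\<in>verts G - S. {w, v} \<in> edges G)"

lemma finite_adj_pairs: "finite X \<Longrightarrow> finite (adj_pairs G X)"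
  by (rule finite_subset[of _ "X \<times> X"]) (auto simp: adj_pairs_def)

lemma sum_adj_eq_card:
  assumes "finite X" "finite Y"
  shows "(\<Sum>i\<in>X. \<Sum>j\<in>Y. adj G i j) = real (card {(i, j). i \<in> X \<and> j \<in> Y \<and> {i, j} \<in> edges G})"
proof -
  have "(\<Sum>i\<in>X. \<Sum>j\<in>Y. adj G i j) = (\<Sum>p\<in>X \<times> Y. if {fst p, snd p} \<in> edges G then 1 else 0)"
    by (simp add: sum.cartesian_product adj_def case_prod_beta)
  also have "\<dots> = (\<Sum>p\<in>{p \<in> X \<times> Y. {fst p, snd p} \<in> edges G}. 1)"
    using assms by (intro sum.inter_filter[symmetric]) auto
  also have "\<dots> = real (card {p \<in> X \<times> Y. {fst p, snd p} \<in> edges G})" by simp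
  also have "{p \<in> X \<times> Y. {fst p, snd p} \<in> edges G} = {(i, j). i \<in> X \<and> j \<in> Y \<and> {i, j} \<in> edges G}"
    by auto
  finally show ?thesis .
qed

lemma sum_adj_square: "finite X \<Longrightarrow> (\<Sum>i\<in>X. \<Sum>j\<in>X. adj G i j) = real (card (adj_pairs G X))"
  unfolding adj_pairs_def by (rule sum_adj_eq_card)

text \<open>The cross terms do not depend on the graph, so they cancel when two graphs joined along
  the same S are compared.\<close>

lemma block_form_fully_joined:
  assumes "fully_joined G S" "verts G = {..<n}"
  shows "block_form (adj G) S ({..<n} - S) x = (\<Sum>i\<in>S. x i) * (\<Sum>j\<in>{..<n} - S. x j)"
proof -
  have "block_form (adj G) S ({..<n} - S) x = (\<Sum>i\<in>S. \<Sum>j\<in>{..<n} - S. x i * x j)"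
    unfolding block_form_def using assms
    by (intro sum.cong refl) (auto simp: adj_def fully_joined_def)
  then show ?thesis by (simp add: sum_product)
qed

section \<open>The Perron vector of a near-extremal graph\<close>

text \<open>The forbidden family is present only through two consequences, the cover
  \<open>C\<close> and the bound \<open>common\<close>. Extremality is not assumed; it returns as
  explicit Rayleigh hypotheses in \<open>S_full\<close>, \<open>core_pairs_max\<close> and
  \<open>outer_pairs_max\<close>.\<close>

locale near_extremal =
  fixes G :: "nat ugraph" and n k c M P :: nat and C :: "nat set"
    and \<rho> :: real and x :: "nat \<Rightarrow> real"
  assumes simple: "fin_simple_graph G" and V: "verts G = {..<n}"
    and k: "k \<ge> 1"
    and C: "C \<subseteq> {..<n}" "card C \<le> c" "\<And>e. e \<in> edges G \<Longrightarrow> e \<inter> C \<noteq> {}"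
    and common: "\<And>L. L \<subseteq> {..<n} \<Longrightarrow> card L = Suc k \<Longrightarrow> card (common_nbrs G L) < M"
    and eig: "\<And>i. i < n \<Longrightarrow> (\<Sum>j<n. adj G i j * x j) = \<rho> * x i"
    and x: "\<And>i. 0 \<le> x i" "\<And>i. i < n \<Longrightarrow> x i \<le> 1" "\<exists>u<n. x u = 1"
    and \<rho>: "real k * (real n - real k) \<le> \<rho>\<^sup>2"
    and large: "large k c M P \<rho>"
begin

definition N :: "nat \<Rightarrow> nat set" where "N v = {u. u < n \<and> {v, u} \<in> edges G}"
definition Bad :: "nat set" where "Bad = {v \<in> {..<n} - C. card (N v) > k}"
definition Good :: "nat set" where "Good = {v \<in> {..<n} - C. card (N v) \<le> k}"

abbreviation D :: real where "D \<equiv> perturb c M \<rho>"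
abbreviation \<epsilon> :: real where "\<epsilon> \<equiv> tail k c M \<rho>"

text \<open>The threshold serves two purposes. A hub misses at most about n / (2 (k + 1)) vertices,
  so k + 1 hubs together miss only about half of all vertices. And neighbours whose total deficit
  from 1 is below 1 / (2 (k + 1)) must all be hubs.\<close>

definition S :: "nat set" where "S = {w. w < n \<and> x w \<ge> 1 - 1 / (2 * (real k + 1))}"

lemma \<rho>_gt: "\<rho> > real k" "\<rho> > real M" "\<rho> > 0"
  using large k by (auto simp: large_def)

lemma \<epsilon>_nonneg: "\<epsilon> \<ge> 0"
  using \<rho>_gt by (simp add: tail_nonneg)

lemma fin: "finite C" "finite (N v)" "finite Bad" "finite Good" "finite S"
  using C(1) by (auto simp: N_def Bad_def Good_def S_def intro: finite_subset[of _ "{..<n}"])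

lemma parts: "{..<n} = C \<union> Bad \<union> Good" "C \<inter> Bad = {}" "(C \<union> Bad) \<inter> Good = {}"
  using C(1) by (auto simp: Bad_def Good_def)

lemma N_sym: "u \<in> N v \<Longrightarrow> v < n \<Longrightarrow> v \<in> N u"
  by (auto simp: N_def insert_commute)

lemma eig_N: "v < n \<Longrightarrow> \<rho> * x v = (\<Sum>u\<in>N v. x u)"
proof -
  assume v: "v < n"
  have "(\<Sum>u\<in>N v. x u) = (\<Sum>j<n. if {v, j} \<in> edges G then x j else 0)"
    by (subst sum.inter_filter[symmetric]) (auto simp: N_def intro: sum.cong)
  also have "\<dots> = (\<Sum>j<n. adj G v j * x j)" by (intro sum.cong) (auto simp: adj_def)
  finally show ?thesis using eig[OF v] by simp
qed

lemma N_outside_cover: "v \<notin> C \<Longrightarrow> N v \<subseteq> C"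
  using C(3) by (fastforce simp: N_def)

text \<open>All neighbours of a vertex outside the cover lie in C. A bad vertex is therefore a
  common neighbour of some (k + 1)-subset of C; there are at most 2^c such subsets, each with fewer
  than M common neighbours.\<close>

lemma card_Bad: "real (card Bad) \<le> 2 ^ c * real M"
proof -
  define Ls where "Ls = {L. L \<subseteq> C \<and> card L = Suc k}"
  have fL: "finite Ls" using fin(1) by (simp add: Ls_def)
  have "Bad \<subseteq> (\<Union>L\<in>Ls. common_nbrs G L)"
  proof
    fix v assume v: "v \<in> Bad"
    then have "Suc k \<le> card (N v)" by (simp add: Bad_def)
    then obtain L where L: "L \<subseteq> N v" "card L = Suc k" by (meson obtain_subset_with_card_n)
    have "L \<in> Ls" using L N_outside_cover[of v] v by (auto simp: Ls_def Bad_def)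
    moreover have "v \<in> common_nbrs G L"
      using L v V by (auto simp: common_nbrs_def N_def Bad_def insert_commute)
    ultimately show "v \<in> (\<Union>L\<in>Ls. common_nbrs G L)" by auto
  qed
  moreover have fc: "finite (common_nbrs G L)" for L by (simp add: common_nbrs_def V)
  ultimately have "card Bad \<le> card (\<Union>L\<in>Ls. common_nbrs G L)" using fL by (intro card_mono) auto
  also have "\<dots> \<le> (\<Sum>L\<in>Ls. card (common_nbrs G L))" using fL by (rule card_UN_le)
  also have "\<dots> \<le> (\<Sum>L\<in>Ls. M)"
    using common C(1) by (intro sum_mono) (auto simp: Ls_def intro: less_imp_le)
  also have "\<dots> = card Ls * M" by simp
  also have "card Ls \<le> card (Pow C)" using fin(1) by (intro card_mono) (auto simp: Ls_def)
  also have "card (Pow C) = 2 ^ card C" using fin(1) by (simp add: card_Pow)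
  also have "(2::nat) ^ card C \<le> 2 ^ c" using C(2) by simp
  finally have "card Bad \<le> 2 ^ c * M" by simp
  then have "real (card Bad) \<le> real (2 ^ c * M)" by (rule of_nat_mono)
  then show ?thesis by simp
qed

section \<open>Two-step walks and the vertices of small degree\<close>

lemma Good_walk_le: "v \<in> Good \<Longrightarrow> \<rho> * x v \<le> real k"
proof -
  assume v: "v \<in> Good"
  then have "\<rho> * x v = (\<Sum>u\<in>N v. x u)" by (intro eig_N) (auto simp: Good_def)
  also have "\<dots> \<le> (\<Sum>u\<in>N v. 1)" using x by (intro sum_mono) (auto simp: N_def)
  also have "\<dots> \<le> real k" using v by (simp add: Good_def)
  finally show ?thesis .
qed

text \<open>Here the two summands of \<open>perturb\<close> arise. At most c neighbours lie in C,
  each contributing at most \<rho>; each neighbour in \<open>Bad\<close> has at most c neighbours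
  itself, so it contributes at most c.\<close>

lemma two_step:
  assumes w: "w < n"
  shows "\<rho>\<^sup>2 * x w \<le> D + (\<Sum>v\<in>N w \<inter> Good. \<rho> * x v)"
proof -
  have "\<rho>\<^sup>2 * x w = \<rho> * (\<Sum>v\<in>N w. x v)" using eig_N[OF w] by (simp add: power2_eq_square)
  also have "\<dots> = (\<Sum>v\<in>N w. \<rho> * x v)" by (simp add: sum_distrib_left)
  also have "\<dots> = (\<Sum>v\<in>(N w \<inter> C) \<union> (N w \<inter> Bad) \<union> (N w \<inter> Good). \<rho> * x v)"
    using parts by (intro sum.cong) (auto simp: N_def)
  also have "\<dots> = (\<Sum>v\<in>(N w \<inter> C) \<union> (N w \<inter> Bad). \<rho> * x v) + (\<Sum>v\<in>N w \<inter> Good. \<rho> * x v)"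
    using fin parts by (intro sum.union_disjoint) auto
  also have "(\<Sum>v\<in>(N w \<inter> C) \<union> (N w \<inter> Bad). \<rho> * x v)
      = (\<Sum>v\<in>N w \<inter> C. \<rho> * x v) + (\<Sum>v\<in>N w \<inter> Bad. \<rho> * x v)"
    using fin parts by (intro sum.union_disjoint) auto
  also have "(\<Sum>v\<in>N w \<inter> C. \<rho> * x v) \<le> real (card (N w \<inter> C)) * \<rho>"
    using x(2) \<rho>_gt by (intro sum_bounded_above) (auto simp: N_def)
  also have "\<dots> \<le> real c * \<rho>"
    using \<rho>_gt C(2) card_mono[of C "N w \<inter> C"] fin by (intro mult_right_mono) auto
  also have "(\<Sum>v\<in>N w \<inter> Bad. \<rho> * x v) \<le> real (card (N w \<inter> Bad)) * real c"
  proof (intro sum_bounded_above)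
    fix v assume "v \<in> N w \<inter> Bad"
    then have v: "v < n" "v \<notin> C" by (auto simp: Bad_def)
    have "\<rho> * x v = (\<Sum>u\<in>N v. x u)" by (rule eig_N[OF v(1)])
    also have "\<dots> \<le> (\<Sum>u\<in>N v. 1)" using x by (intro sum_mono) (auto simp: N_def)
    also have "\<dots> \<le> real c"
      using card_mono[OF fin(1) N_outside_cover[OF v(2)]] C(2) by simp
    finally show "\<rho> * x v \<le> real c" .
  qed
  also have "\<dots> \<le> 2 ^ c * real M * real c"
  proof (intro mult_right_mono)
    have "card (N w \<inter> Bad) \<le> card Bad" using fin by (intro card_mono) auto
    then show "real (card (N w \<inter> Bad)) \<le> 2 ^ c * real M" using card_Bad by linarith
  qed simp
  finally show ?thesis by (simp add: perturb_def)
qed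

lemma two_step':
  assumes w: "w < n"
  shows "\<rho>\<^sup>2 * x w \<le> D + real k * real (card (N w \<inter> Good))"
proof -
  have "(\<Sum>v\<in>N w \<inter> Good. \<rho> * x v) \<le> real (card (N w \<inter> Good)) * real k"
    using Good_walk_le by (intro sum_bounded_above) auto
  then show ?thesis using two_step[OF w] by (simp add: mult.commute)
qed

lemma card_Good_le: "card Good \<le> n"
  using card_mono[of "{..<n}" Good] by (auto simp: Good_def)

text \<open>At a vertex of entry 1 the two-step bound gives \<rho>^2 at most D plus the walk weights
  of \<open>Good\<close>, whereas \<rho>^2 is at least k(n - k). Each good vertex contributes at
  most k, so the total shortfall is O(\<rho>), small against n, which has order \<rho>^2.\<close>

lemma sum_deficit: "(\<Sum>v\<in>Good. real k - \<rho> * x v) \<le> (real k)\<^sup>2 + D"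
proof -
  obtain u where u: "u < n" "x u = 1" using x(3) by auto
  have "\<rho>\<^sup>2 \<le> D + (\<Sum>v\<in>N u \<inter> Good. \<rho> * x v)" using two_step[OF u(1)] u(2) by simp
  also have "(\<Sum>v\<in>N u \<inter> Good. \<rho> * x v) \<le> (\<Sum>v\<in>Good. \<rho> * x v)"
    using fin x(1) \<rho>_gt by (intro sum_mono2) auto
  finally have "\<rho>\<^sup>2 \<le> D + (\<Sum>v\<in>Good. \<rho> * x v)" by simp
  moreover have "real k * real (card Good) \<le> real k * real n"
    using card_Good_le by (intro mult_left_mono) auto
  ultimately show ?thesis using \<rho> by (simp add: sum_subtractf power2_eq_square algebra_simps)
qed

text \<open>Converts the conditions on \<rho> in \<open>large\<close> into lower bounds on
  n.\<close>

lemma n_ge: "\<rho>\<^sup>2 - D \<le> real k * real n"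
proof -
  obtain u where u: "u < n" "x u = 1" using x(3) by auto
  have "\<rho>\<^sup>2 \<le> D + real k * real (card (N u \<inter> Good))" using two_step'[OF u(1)] u(2) by simp
  also have "real k * real (card (N u \<inter> Good)) \<le> real k * real n"
    using card_Good_le card_mono[of Good "N u \<inter> Good"] fin by (intro mult_left_mono) auto
  finally show ?thesis by simp
qed

section \<open>The hubs: their number, and the decay of the vector away from them\<close>

lemma hub_non_nbrs:
  assumes w: "w \<in> S"
  shows "real k * real (card ({..<n} - N w)) \<le> (real k)\<^sup>2 + D + \<rho>\<^sup>2 / (2 * (real k + 1))"
proof -
  have wn: "w < n" and xw: "1 - 1 / (2 * (real k + 1)) \<le> x w" using w by (auto simp: S_def)
  have "\<rho>\<^sup>2 * (1 - 1 / (2 * (real k + 1))) \<le> \<rho>\<^sup>2 * x w"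
    using xw by (intro mult_left_mono) auto
  also have "\<dots> \<le> D + real k * real (card (N w \<inter> Good))" by (rule two_step'[OF wn])
  also have "real k * real (card (N w \<inter> Good)) \<le> real k * real (card (N w))"
    using card_mono[of "N w" "N w \<inter> Good"] fin by (intro mult_left_mono) auto
  finally have 1: "\<rho>\<^sup>2 - \<rho>\<^sup>2 / (2 * (real k + 1)) \<le> D + real k * real (card (N w))"
    by (simp add: algebra_simps)
  have sub: "N w \<subseteq> {..<n}" by (auto simp: N_def)
  have "card ({..<n} - N w) + card (N w) = n"
    using card_Diff_subset[OF fin(2) sub] card_mono[OF _ sub] by simp
  then have "real (card ({..<n} - N w)) = real n - real (card (N w))" by linarith
  then have "real k * real (card ({..<n} - N w)) = real k * real n - real k * real (card (N w))"
    by (simp only: right_diff_distrib)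
  also have "\<dots> \<le> (real k)\<^sup>2 + \<rho>\<^sup>2 - real k * real (card (N w))"
    using \<rho> by (simp add: algebra_simps power2_eq_square)
  also have "\<dots> \<le> (real k)\<^sup>2 + D + \<rho>\<^sup>2 / (2 * (real k + 1))" using 1 by simp
  finally show ?thesis .
qed

text \<open>By the choice of the threshold, k + 1 hubs miss together at most about \<rho>^2 / (2k)
  vertices, so at least M vertices are adjacent to all of them, against
  \<open>common\<close>.\<close>

lemma card_S_le: "card S \<le> k"
proof (rule ccontr)
  assume "\<not> card S \<le> k"
  then have "Suc k \<le> card S" by simp
  then obtain L where L: "L \<subseteq> S" "card L = Suc k" by (meson obtain_subset_with_card_n)
  then have fL: "finite L" by (metis card.infinite nat.distinct(1))
  have Ln: "L \<subseteq> {..<n}" using L by (auto simp: S_def)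
  have "{..<n} \<subseteq> common_nbrs G L \<union> (\<Union>w\<in>L. {..<n} - N w)"
    using V by (auto simp: common_nbrs_def N_def)
  moreover have "finite (common_nbrs G L \<union> (\<Union>w\<in>L. {..<n} - N w))"
    using fL V by (auto simp: common_nbrs_def)
  ultimately have "card {..<n} \<le> card (common_nbrs G L \<union> (\<Union>w\<in>L. {..<n} - N w))"
    by (rule card_mono[rotated])
  then have "n \<le> card (common_nbrs G L \<union> (\<Union>w\<in>L. {..<n} - N w))" by simp
  also have "\<dots> \<le> card (common_nbrs G L) + card (\<Union>w\<in>L. {..<n} - N w)" by (rule card_Un_le)
  also have "\<dots> \<le> card (common_nbrs G L) + (\<Sum>w\<in>L. card ({..<n} - N w))"
    using card_UN_le[OF fL] by (intro add_left_mono)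
  finally have "real n \<le> real (card (common_nbrs G L) + (\<Sum>w\<in>L. card ({..<n} - N w)))"
    by (rule of_nat_mono)
  then have "real n \<le> real (card (common_nbrs G L)) + (\<Sum>w\<in>L. real (card ({..<n} - N w)))"
    by simp
  then have "real k * real n
      \<le> real k * (real (card (common_nbrs G L)) + (\<Sum>w\<in>L. real (card ({..<n} - N w))))"
    by (rule mult_left_mono) simp
  also have "\<dots> = real k * real (card (common_nbrs G L))
      + (\<Sum>w\<in>L. real k * real (card ({..<n} - N w)))"
    by (simp add: distrib_left sum_distrib_left)
  also have "(\<Sum>w\<in>L. real k * real (card ({..<n} - N w)))
      \<le> real (card L) * ((real k)\<^sup>2 + D + \<rho>\<^sup>2 / (2 * (real k + 1)))"
    using hub_non_nbrs L by (intro sum_bounded_above) auto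
  also have "\<dots> = (real k + 1) * ((real k)\<^sup>2 + D) + \<rho>\<^sup>2 / 2"
    using L(2) by (simp add: field_simps)
  finally have "real k * real n
      \<le> real k * real (card (common_nbrs G L)) + ((real k + 1) * ((real k)\<^sup>2 + D) + \<rho>\<^sup>2 / 2)"
    by simp
  moreover have "real k * real M + real (k + 1) * (real k ^ 2 + D) + D \<le> \<rho>\<^sup>2 / 2"
    using large unfolding large_def by blast
  ultimately have "real k * real M \<le> real k * real (card (common_nbrs G L))"
    using n_ge by (simp add: add.commute[of 1])
  then have "M \<le> card (common_nbrs G L)" using k by simp
  then show False using common[OF Ln L(2)] by simp
qed

definition Q :: "nat set" where "Q = {v \<in> Good. N v \<noteq> S}"

text \<open>The deficits 1 - x u over the neighbours of v add up to the degree minus \<rho> x v.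
  Nonnegativity forces degree k; then every single deficit is below the hub threshold, so N v is
  contained in S, and \<open>card_S_le\<close> gives equality.\<close>

lemma Good_large_N:
  assumes v: "v \<in> Good" and gt: "\<rho> * x v > real k - 1 / (2 * (real k + 1))"
  shows "N v = S \<and> card S = k"
proof -
  have vn: "v < n" using v by (simp add: Good_def)
  have "(\<Sum>u\<in>N v. 1 - x u) = real (card (N v)) - \<rho> * x v"
    by (simp add: sum_subtractf eig_N[OF vn])
  then have s: "(\<Sum>u\<in>N v. 1 - x u) < real (card (N v)) - real k + 1 / (2 * (real k + 1))"
    using gt by simp
  have nn: "1 - x u \<ge> 0" if "u \<in> N v" for u using that x(2) by (simp add: N_def)
  have "(\<Sum>u\<in>N v. 1 - x u) \<ge> 0" using nn by (intro sum_nonneg)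
  then have "real k < real (card (N v)) + 1 / (2 * (real k + 1))" using s by linarith
  also have "1 / (2 * (real k + 1)) < 1" by (simp add: field_simps)
  finally have "real k < real (card (N v) + 1)" by simp
  then have c: "card (N v) = k" using v unfolding of_nat_less_iff by (simp add: Good_def)
  have "u \<in> S" if u: "u \<in> N v" for u
  proof -
    have "1 - x u \<le> (\<Sum>u\<in>N v. 1 - x u)" using u nn fin by (intro member_le_sum) auto
    then show ?thesis using s c u by (simp add: S_def N_def)
  qed
  then have "N v \<subseteq> S" by auto
  then show ?thesis using card_S_le c fin by (metis card_mono card_subset_eq le_antisym)
qed

text \<open>Markov's inequality: each vertex of Q has deficit at least 1 / (2 (k + 1)), and
  \<open>sum_deficit\<close> bounds the total.\<close>

lemma card_Q: "real (card Q) \<le> 2 * real (k + 1) * ((real k)\<^sup>2 + D)"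
proof -
  have "real (card Q) * (1 / (2 * (real k + 1))) \<le> (\<Sum>v\<in>Q. real k - \<rho> * x v)"
    using Good_large_N by (intro sum_bounded_below) (force simp: Q_def not_less)
  also have "\<dots> \<le> (\<Sum>v\<in>Good. real k - \<rho> * x v)"
    using Good_walk_le fin by (intro sum_mono2) (auto simp: Q_def)
  also have "\<dots> \<le> (real k)\<^sup>2 + D" by (rule sum_deficit)
  finally show ?thesis by (simp add: field_simps)
qed

text \<open>The last summand is the bound on Q. The 1 guarantees a good vertex of small deficit,
  hence exactly k hubs; P counts the common neighbours of S that remain.\<close>

lemma card_Good_ge: "real P + 1 + 2 * real (k + 1) * ((real k)\<^sup>2 + D) \<le> real (card Good)"
proof -
  have "n = card (C \<union> Bad \<union> Good)" using parts(1) by (metis card_lessThan)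
  also have "\<dots> \<le> card (C \<union> Bad) + card Good" by (rule card_Un_le)
  also have "\<dots> \<le> card C + card Bad + card Good" using card_Un_le[of C Bad] by simp
  finally have "real n \<le> real (card C) + real (card Bad) + real (card Good)" by linarith
  moreover have "real (card C) \<le> real c" using C(2) by simp
  ultimately have 1: "real n - real c - 2 ^ c * real M \<le> real (card Good)" using card_Bad by linarith
  have "real k * (real P + 1 + real c + 2 ^ c * real M + 2 * real (k + 1) * (real k ^ 2 + D)) + D \<le> \<rho>\<^sup>2"
    using large unfolding large_def by blast
  then have "real k * (real P + 1 + real c + 2 ^ c * real M + 2 * real (k + 1) * (real k ^ 2 + D))
    \<le> real k * real n" using n_ge by linarith
  then have "real P + 1 + real c + 2 ^ c * real M + 2 * real (k + 1) * (real k ^ 2 + D) \<le> real n"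
    using k by (subst (asm) mult_le_cancel_left_pos) auto
  then show ?thesis using 1 by linarith
qed

lemma card_S: "card S = k"
proof -
  have "\<exists>v\<in>Good. \<rho> * x v > real k - 1 / (2 * (real k + 1))"
  proof (rule ccontr)
    assume H: "\<not> ?thesis"
    have "real (card Good) * (1 / (2 * (real k + 1))) \<le> (\<Sum>v\<in>Good. real k - \<rho> * x v)"
      using H by (intro sum_bounded_below) (force simp: not_less)
    also have "\<dots> \<le> (real k)\<^sup>2 + D" by (rule sum_deficit)
    finally have "real (card Good) \<le> 2 * real (k + 1) * ((real k)\<^sup>2 + D)" by (simp add: field_simps)
    then show False using card_Good_ge by linarith
  qed
  then show ?thesis using Good_large_N by blast
qed

lemma S_subset: "S \<subseteq> {..<n}"
  by (auto simp: S_def)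

lemma S_ge_half: "w \<in> S \<Longrightarrow> x w \<ge> 1 / 2"
proof -
  assume "w \<in> S"
  moreover have "1 / (2 * (real k + 1)) \<le> 1 / 2" by (simp add: field_simps)
  ultimately show ?thesis unfolding S_def mem_Collect_eq by linarith
qed

text \<open>A good vertex with neighbourhood S has no neighbour outside S. So all good neighbours of
  z lie in Q, few walks of length two start at z, and the two-step bound is exactly
  \<open>tail\<close>.\<close>

lemma outside_S_le:
  assumes z: "z < n" "z \<notin> S"
  shows "x z \<le> \<epsilon>"
proof -
  have "N z \<inter> Good \<subseteq> Q" using z N_sym[of _ z] by (auto simp: Q_def)
  then have "card (N z \<inter> Good) \<le> card Q" using fin by (intro card_mono) (auto simp: Q_def)
  then have "real (card (N z \<inter> Good)) \<le> 2 * real (k + 1) * ((real k)\<^sup>2 + D)"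
    using card_Q by linarith
  then have "real k * real (card (N z \<inter> Good)) \<le> real k * (2 * real (k + 1) * ((real k)\<^sup>2 + D))"
    by (intro mult_left_mono) auto
  then have "\<rho>\<^sup>2 * x z \<le> D + real k * (2 * real (k + 1) * ((real k)\<^sup>2 + D))"
    using two_step'[OF z(1)] by linarith
  then have "\<rho>\<^sup>2 * x z \<le> D + 2 * real k * real (k + 1) * ((real k)\<^sup>2 + D)"
    by (simp only: mult.assoc mult.left_commute[of "real k" 2])
  then show ?thesis using \<rho>_gt unfolding tail_def by (subst pos_le_divide_eq) (auto simp: mult.commute)
qed

lemma card_common_nbrs_S: "P \<le> card (common_nbrs G S)"
proof -
  have "Q \<subseteq> Good" by (auto simp: Q_def)
  then have "card Good - card Q \<le> card (Good - Q)"
    using finite_subset[OF _ fin(4)] by (intro diff_card_le_card_Diff) auto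
  also have "\<dots> \<le> card (common_nbrs G S)"
  proof (rule card_mono)
    show "finite (common_nbrs G S)" by (simp add: common_nbrs_def V)
    show "Good - Q \<subseteq> common_nbrs G S"
    proof
      fix v assume "v \<in> Good - Q"
      then have "v < n" "N v = S" by (auto simp: Q_def Good_def)
      then show "v \<in> common_nbrs G S" by (auto simp: common_nbrs_def V N_def insert_commute)
    qed
  qed
  finally have "real (card Good) - real (card Q) \<le> real (card (common_nbrs G S))" by linarith
  then have "real P \<le> real (card (common_nbrs G S))" using card_Good_ge card_Q by linarith
  then show ?thesis by simp
qed

section \<open>Completing the join between the hubs and the rest\<close>

definition R :: "nat set" where "R = {v. v < n \<and> v \<notin> S \<and> \<not> S \<subseteq> N v}"

lemma R_subset: "R \<subseteq> {..<n}" "R \<inter> S = {}"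
  by (auto simp: R_def)

lemma quad_form_eigen: "quad_form n (adj G) x = \<rho> * (\<Sum>i<n. (x i)\<^sup>2)"
proof -
  have "quad_form n (adj G) x = (\<Sum>i<n. x i * (\<Sum>j<n. adj G i j * x j))"
    by (simp add: quad_form_def sum_distrib_left mult_ac)
  also have "\<dots> = (\<Sum>i<n. \<rho> * (x i)\<^sup>2)"
    by (intro sum.cong) (auto simp: eig power2_eq_square)
  finally show ?thesis by (simp add: sum_distrib_left)
qed

text \<open>An edge lost at \<open>i \<in> R\<close> has an end in the cover. It is charged to \<open>i\<close> unless its other end \<open>j\<close>
  is an unexceptional vertex outside the cover; then \<open>j \<in> R\<close>, and \<open>j\<close> is charged at
  most once by each vertex of the cover.\<close>

lemma rejoin_loss:
  "(\<Sum>i\<in>R. \<Sum>j\<in>{..<n} - S. adj G i j * x i * x j)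
     \<le> (2 * real c + 2 ^ c * real M) * \<epsilon> * (\<Sum>i\<in>R. x i)"
proof -
  have fR: "finite R" using R_subset finite_subset by blast
  define s where "s = (\<Sum>i\<in>R. x i)"
  have s0: "s \<ge> 0" unfolding s_def using x(1) by (intro sum_nonneg)
  define g where "g i j = (if j \<in> C then x i else 0) + (if j \<in> Bad then x i else 0)
      + (if i \<in> C \<and> j \<in> R then x j else 0)" for i j
  have g0: "g i j \<ge> 0" for i j using x(1) by (simp add: g_def)
  have pt: "adj G i j * x i * x j \<le> \<epsilon> * g i j" if i: "i \<in> R" and j: "j \<in> {..<n} - S" for i j
  proof (cases "{i, j} \<in> edges G")
    case False
    then show ?thesis using g0 \<epsilon>_nonneg by (simp add: adj_def)
  next
    case e: True
    have xj: "x j \<le> \<epsilon>" using j by (intro outside_S_le) auto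
    have xi: "x i \<le> \<epsilon>" using i by (intro outside_S_le) (auto simp: R_def)
    consider "j \<in> C \<or> j \<in> Bad" | "j \<notin> C" "j \<notin> Bad" by blast
    then have "x i * x j \<le> \<epsilon> * g i j"
    proof cases
      case 1
      then have "x i \<le> g i j" using x(1) by (auto simp: g_def)
      then have "x j * x i \<le> \<epsilon> * g i j" using xj x(1) \<epsilon>_nonneg by (intro mult_mono) auto
      then show ?thesis by (simp add: mult.commute)
    next
      case 2
      have iC: "i \<in> C" using C(3)[OF e] 2 by auto
      have "j \<in> R"
      proof (rule ccontr)
        assume "j \<notin> R"
        then have "S \<subseteq> N j" using j by (auto simp: R_def)
        moreover have "i \<in> N j" using e i by (auto simp: N_def R_def insert_commute)
        ultimately have "insert i S \<subseteq> N j" by auto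
        then have "card (insert i S) \<le> card (N j)" using fin by (intro card_mono)
        moreover have "card (insert i S) = Suc k" using i card_S fin by (simp add: R_def)
        ultimately show False using 2 j by (simp add: Bad_def)
      qed
      then have "x j \<le> g i j" using iC x(1) by (auto simp: g_def)
      then show ?thesis using xi x(1) \<epsilon>_nonneg by (intro mult_mono) auto
    qed
    then show ?thesis using e by (simp add: adj_def)
  qed
  have fV: "finite ({..<n} - S)" by simp
  have count: "(\<Sum>j\<in>{..<n} - S. if j \<in> A then a else 0) \<le> b * a"
    if "a \<ge> 0" "finite A" "real (card A) \<le> b" for A and a b :: real
  proof -
    have "(\<Sum>j\<in>{..<n} - S. if j \<in> A then a else 0) = real (card (({..<n} - S) \<inter> A)) * a"
      by (simp add: sum.inter_restrict[symmetric])
    also have "\<dots> \<le> b * a"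
    proof (intro mult_right_mono that)
      have "card (({..<n} - S) \<inter> A) \<le> card A" using that by (intro card_mono) auto
      then show "real (card (({..<n} - S) \<inter> A)) \<le> b" using that by linarith
    qed
    finally show ?thesis .
  qed
  have cC: "real (card C) \<le> real c" using C(2) by simp
  have "(\<Sum>i\<in>R. \<Sum>j\<in>{..<n} - S. adj G i j * x i * x j) \<le> (\<Sum>i\<in>R. \<Sum>j\<in>{..<n} - S. \<epsilon> * g i j)"
    using pt by (intro sum_mono) auto
  also have "\<dots> = \<epsilon> * (\<Sum>i\<in>R. \<Sum>j\<in>{..<n} - S. g i j)" by (simp add: sum_distrib_left)
  also have "(\<Sum>i\<in>R. \<Sum>j\<in>{..<n} - S. g i j) =
      (\<Sum>i\<in>R. \<Sum>j\<in>{..<n} - S. if j \<in> C then x i else 0)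
      + (\<Sum>i\<in>R. \<Sum>j\<in>{..<n} - S. if j \<in> Bad then x i else 0)
      + (\<Sum>i\<in>R. \<Sum>j\<in>{..<n} - S. if i \<in> C \<and> j \<in> R then x j else 0)"
    by (simp add: g_def sum.distrib)
  also have "(\<Sum>i\<in>R. \<Sum>j\<in>{..<n} - S. if j \<in> C then x i else 0) \<le> (\<Sum>i\<in>R. real c * x i)"
    using x(1) fin cC by (intro sum_mono count)
  also have "(\<Sum>i\<in>R. real c * x i) = real c * s" by (simp add: s_def sum_distrib_left)
  also have "(\<Sum>i\<in>R. \<Sum>j\<in>{..<n} - S. if j \<in> Bad then x i else 0) \<le> (\<Sum>i\<in>R. 2 ^ c * real M * x i)"
    using x(1) fin card_Bad by (intro sum_mono count)
  also have "(\<Sum>i\<in>R. 2 ^ c * real M * x i) = 2 ^ c * real M * s" by (simp add: s_def sum_distrib_left)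
  also have "(\<Sum>i\<in>R. \<Sum>j\<in>{..<n} - S. if i \<in> C \<and> j \<in> R then x j else 0) = (\<Sum>i\<in>R. if i \<in> C then s else 0)"
  proof (intro sum.cong refl)
    fix i
    have "({..<n} - S) \<inter> R = R" using R_subset by auto
    then have "(\<Sum>j\<in>{..<n} - S. if j \<in> R then x j else 0) = s"
      by (simp add: sum.inter_restrict[symmetric] s_def)
    then show "(\<Sum>j\<in>{..<n} - S. if i \<in> C \<and> j \<in> R then x j else 0) = (if i \<in> C then s else 0)"
      by (cases "i \<in> C") auto
  qed
  also have "(\<Sum>i\<in>R. if i \<in> C then s else 0) = real (card (R \<inter> C)) * s"
    using fR by (simp add: sum.inter_restrict[symmetric])
  also have "\<dots> \<le> real c * s"
    using s0 C(2) card_mono[OF fin(1), of "R \<inter> C"] by (intro mult_right_mono) auto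
  finally have "(\<Sum>i\<in>R. \<Sum>j\<in>{..<n} - S. adj G i j * x i * x j) \<le> \<epsilon> * (real c * s + 2 ^ c * real M * s + real c * s)"
    using \<epsilon>_nonneg by (simp add: mult_left_mono)
  then show ?thesis unfolding s_def[symmetric] by (simp add: algebra_simps)
qed

text \<open>A vertex i of R misses at least one hub, whose entry is at least 1/2, so joining it to S
  gains at least x i / 2. \<open>rejoin_loss\<close> bounds what is given up; the factor 2 comes
  from ordered pairs.\<close>

lemma rejoin_gain:
  "quad_form n (adj (rejoin G S R)) x - quad_form n (adj G) x
     \<ge> 2 * (1 / 2 - (2 * real c + 2 ^ c * real M) * \<epsilon>) * (\<Sum>i\<in>R. x i)"
proof -
  let ?a = "adj G" and ?b = "adj (rejoin G S R)"
  have fR: "finite R" using R_subset finite_subset by blast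
  \<comment> \<open>The change is charged to the endpoint in R. An edge with both ends in R is
    subtracted at each of them, which is why \<open>pt\<close> is only an inequality.\<close>
  define g where "g i j = (if i \<in> R then (if j \<in> S then 1 - ?a i j else - ?a i j) else 0)" for i j
  have pt: "g i j + g j i \<le> ?b i j - ?a i j" for i j
  proof -
    have b: "?b i j = (if i \<in> R \<and> j \<in> S \<or> j \<in> R \<and> i \<in> S then 1
        else if i \<in> R \<or> j \<in> R then 0 else ?a i j)"
      using R_subset(2) by (auto simp: adj_def rejoin_def doubleton_eq_iff)
    show ?thesis unfolding b g_def using R_subset(2) adj_nonneg[of G i j] adj_sym[of G i j]
      by (auto split: if_splits)
  qed
  have "(\<Sum>i<n. \<Sum>j<n. (g i j + g j i) * (x i * x j)) \<le> (\<Sum>i<n. \<Sum>j<n. (?b i j - ?a i j) * (x i * x j))"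
    using pt x(1) by (intro sum_mono mult_right_mono) auto
  also have "\<dots> = quad_form n ?b x - quad_form n ?a x"
    by (simp add: quad_form_def sum_subtractf left_diff_distrib mult.assoc)
  finally have 1: "(\<Sum>i<n. \<Sum>j<n. (g i j + g j i) * (x i * x j)) \<le> quad_form n ?b x - quad_form n ?a x" .
  have "(\<Sum>i<n. \<Sum>j<n. g j i * (x i * x j)) = (\<Sum>i<n. \<Sum>j<n. g i j * (x i * x j))"
    by (subst sum.swap) (simp add: mult_ac)
  then have 2: "(\<Sum>i<n. \<Sum>j<n. (g i j + g j i) * (x i * x j)) = 2 * (\<Sum>i<n. \<Sum>j<n. g i j * (x i * x j))"
    by (simp add: distrib_right sum.distrib)
  have "(\<Sum>i<n. \<Sum>j<n. g i j * (x i * x j)) = (\<Sum>i\<in>R. \<Sum>j<n. g i j * (x i * x j))"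
    using R_subset by (intro sum.mono_neutral_right) (auto simp: g_def)
  also have "\<dots> = (\<Sum>i\<in>R. (\<Sum>j\<in>S. (1 - ?a i j) * (x i * x j)) - (\<Sum>j\<in>{..<n} - S. ?a i j * x i * x j))"
  proof (intro sum.cong refl)
    fix i assume i: "i \<in> R"
    have "(\<Sum>j<n. g i j * (x i * x j)) = (\<Sum>j\<in>S. g i j * (x i * x j)) + (\<Sum>j\<in>{..<n} - S. g i j * (x i * x j))"
      using sum.subset_diff[OF S_subset, of "\<lambda>j. g i j * (x i * x j)"] by simp
    also have "(\<Sum>j\<in>S. g i j * (x i * x j)) = (\<Sum>j\<in>S. (1 - ?a i j) * (x i * x j))"
      using i by (intro sum.cong) (auto simp: g_def)
    also have "(\<Sum>j\<in>{..<n} - S. g i j * (x i * x j)) = (\<Sum>j\<in>{..<n} - S. - (?a i j * x i * x j))"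
      using i by (intro sum.cong) (auto simp: g_def)
    finally show "(\<Sum>j<n. g i j * (x i * x j)) =
      (\<Sum>j\<in>S. (1 - ?a i j) * (x i * x j)) - (\<Sum>j\<in>{..<n} - S. ?a i j * x i * x j)"
      by (simp add: sum_negf)
  qed
  also have "\<dots> = (\<Sum>i\<in>R. \<Sum>j\<in>S. (1 - ?a i j) * (x i * x j)) - (\<Sum>i\<in>R. \<Sum>j\<in>{..<n} - S. ?a i j * x i * x j)"
    by (simp add: sum_subtractf)
  finally have 3: "(\<Sum>i<n. \<Sum>j<n. g i j * (x i * x j)) = (\<Sum>i\<in>R. \<Sum>j\<in>S. (1 - ?a i j) * (x i * x j))
     - (\<Sum>i\<in>R. \<Sum>j\<in>{..<n} - S. ?a i j * x i * x j)" .
  have "(\<Sum>i\<in>R. 1 / 2 * x i) \<le> (\<Sum>i\<in>R. \<Sum>j\<in>S. (1 - ?a i j) * (x i * x j))"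
  proof (intro sum_mono)
    fix i assume i: "i \<in> R"
    then obtain w where w: "w \<in> S" "{i, w} \<notin> edges G" by (auto simp: R_def N_def S_def)
    have "1 / 2 * x i \<le> (1 - ?a i w) * (x i * x w)"
      using w S_ge_half[of w] x(1)[of i] mult_left_mono[of "1/2" "x w" "x i"] by (simp add: adj_def)
    also have "\<dots> \<le> (\<Sum>j\<in>S. (1 - ?a i j) * (x i * x j))"
      using w fin x(1) adj_le_1 by (intro member_le_sum[of w S "\<lambda>j. (1 - ?a i j) * (x i * x j)"]) auto
    finally show "1 / 2 * x i \<le> (\<Sum>j\<in>S. (1 - ?a i j) * (x i * x j))" .
  qed
  then have 4: "1 / 2 * (\<Sum>i\<in>R. x i) \<le> (\<Sum>i\<in>R. \<Sum>j\<in>S. (1 - ?a i j) * (x i * x j))"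
    by (simp add: sum_distrib_left)
  have "2 * (h - l) \<le> q" if "t \<le> q" "t = 2 * u" "u = p - r" "h \<le> p" "r \<le> l" for h l p q r t u :: real
    using that by simp
  from this[OF 1 2 3 4 rejoin_loss] show ?thesis by (simp add: algebra_simps)
qed

text \<open>The gain is a positive multiple of the sum of x over R, so maximality forces x to vanish
  on R. Then x attains the Rayleigh bound for the rejoined graph too and is an eigenvector of it.
  But there a vertex of R has entry 0 and a hub with entry at least 1/2 as a neighbour, which the
  eigenvalue equation forbids.\<close>

lemma S_full:
  assumes max: "\<And>y. quad_form n (adj (rejoin G S R)) y \<le> \<rho> * (\<Sum>i<n. (y i)\<^sup>2)"
  shows "R = {}"
proof (rule ccontr)
  assume "R \<noteq> {}"
  then obtain v where v: "v \<in> R" by auto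
  let ?b = "adj (rejoin G S R)"
  define s where "s = (\<Sum>i\<in>R. x i)"
  have fR: "finite R" using R_subset finite_subset by blast
  have s0: "s \<ge> 0" unfolding s_def using x(1) by (intro sum_nonneg)
  define d where "d = 2 * (1 / 2 - (2 * real c + 2 ^ c * real M) * \<epsilon>)"
  have d: "d > 0" using large unfolding large_def d_def by auto
  have g: "d * s \<le> quad_form n ?b x - quad_form n (adj G) x"
    using rejoin_gain unfolding d_def s_def .
  then have "d * s \<le> 0" using max[of x] quad_form_eigen by simp
  then have "s \<le> 0" using d by (simp add: mult_le_0_iff)
  then have "s = 0" using s0 by simp
  then have xv: "x v = 0" using v fR x(1) unfolding s_def by (subst (asm) sum_nonneg_eq_0_iff) auto
  have "quad_form n ?b x \<ge> quad_form n (adj G) x" using g \<open>s = 0\<close> by simp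
  then have eq: "quad_form n ?b x = \<rho> * (\<Sum>i<n. (x i)\<^sup>2)"
    using max[of x] quad_form_eigen by simp
  have vn: "v < n" using v R_subset by auto
  have "(\<Sum>j<n. ?b v j * x j) = \<rho> * x v"
    by (rule rayleigh_equality_imp_eigenvector[OF adj_sym max eq vn])
  then have z: "(\<Sum>j<n. ?b v j * x j) = 0" using xv by simp
  obtain w where w: "w \<in> S" using card_S k by fastforce
  have "?b v w * x w \<le> (\<Sum>j<n. ?b v j * x j)"
    using w S_subset x(1) adj_nonneg by (intro member_le_sum[of w _ "\<lambda>j. ?b v j * x j"]) auto
  moreover have "?b v w = 1" using v w by (auto simp: adj_def rejoin_def doubleton_eq_iff)
  ultimately show False using z S_ge_half[OF w] by simp
qed

section \<open>Comparing edges inside and outside the core\<close>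

abbreviation H where "H \<equiv> {..<n} - S"

lemma fully_joined_S:
  assumes "R = {}"
  shows "fully_joined G S"
  unfolding fully_joined_def
proof (intro ballI)
  fix w v assume wv: "w \<in> S" "v \<in> verts G - S"
  then have "w \<in> N v" using assms by (auto simp: R_def V)
  then show "{w, v} \<in> edges G" by (simp add: N_def insert_commute)
qed

text \<open>A neighbour of v in H is adjacent to v and to all of S, hence is a common neighbour of k
  + 1 vertices.\<close>

lemma H_degree:
  assumes full: "R = {}" and v: "v \<in> H"
  shows "card {u \<in> H. {v, u} \<in> edges G} < M"
proof -
  have "{u \<in> H. {v, u} \<in> edges G} \<subseteq> common_nbrs G (insert v S)"
    using fully_joined_S[OF full] by (auto simp: common_nbrs_def V fully_joined_def)
  then have "card {u \<in> H. {v, u} \<in> edges G} \<le> card (common_nbrs G (insert v S))"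
    by (intro card_mono) (auto simp: common_nbrs_def V)
  also have "\<dots> < M" using v S_subset card_S fin by (intro common) auto
  finally show ?thesis .
qed

text \<open>Every edge in H has an end in C, and each of the at most c possible ends has fewer than
  M neighbours in H. The 2 accounts for both orders of a pair.\<close>

lemma card_H_pairs:
  assumes full: "R = {}"
  shows "real (card (adj_pairs G H)) \<le> 2 * real c * real M"
proof -
  have "real (card (adj_pairs G H)) = (\<Sum>i\<in>H. \<Sum>j\<in>H. adj G i j)" by (simp add: sum_adj_square)
  also have "\<dots> \<le> (\<Sum>i\<in>H. \<Sum>j\<in>H. (if i \<in> C then adj G i j else 0) + (if j \<in> C then adj G i j else 0))"
    using C(3) by (intro sum_mono) (fastforce simp: adj_def)
  also have "\<dots> = (\<Sum>i\<in>H. \<Sum>j\<in>H. if i \<in> C then adj G i j else 0) + (\<Sum>i\<in>H. \<Sum>j\<in>H. if j \<in> C then adj G i j else 0)"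
    by (simp add: sum.distrib)
  also have "(\<Sum>i\<in>H. \<Sum>j\<in>H. if j \<in> C then adj G i j else 0) = (\<Sum>i\<in>H. \<Sum>j\<in>H. if i \<in> C then adj G i j else 0)"
    by (subst sum.swap) (simp add: adj_sym cong: if_cong)
  also have "(\<Sum>i\<in>H. \<Sum>j\<in>H. if i \<in> C then adj G i j else 0) \<le> (\<Sum>i\<in>H. if i \<in> C then real M else 0)"
  proof (intro sum_mono)
    fix i assume i: "i \<in> H"
    have "(\<Sum>j\<in>H. adj G i j) = real (card {u \<in> H. {i, u} \<in> edges G})"
      by (simp add: adj_def sum.inter_filter[symmetric])
    also have "\<dots> \<le> real M" using H_degree[OF full i] by simp
    finally show "(\<Sum>j\<in>H. if i \<in> C then adj G i j else 0) \<le> (if i \<in> C then real M else 0)" by simp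
  qed
  also have "(\<Sum>i\<in>H. if i \<in> C then real M else 0) = real (card (H \<inter> C)) * real M"
    by (simp add: sum.inter_restrict[symmetric])
  also have "\<dots> \<le> real c * real M"
    using C(2) card_mono[OF fin(1), of "H \<inter> C"] by (intro mult_right_mono) auto
  finally show ?thesis by (simp add: mult_ac)
qed

text \<open>A hub sees all of H. Its neighbour sum is therefore at least that of a vertex of entry
  1, up to the total weight of S, which is at most k.\<close>

lemma S_near_one:
  assumes full: "R = {}" and w: "w \<in> S"
  shows "x w \<ge> 1 - real k / \<rho>"
proof -
  obtain u where u: "u < n" "x u = 1" using x(3) by auto
  have "\<rho> = (\<Sum>j\<in>N u. x j)" using eig_N[OF u(1)] u(2) by simp
  also have "\<dots> \<le> (\<Sum>j<n. x j)" using x(1) by (intro sum_mono2) (auto simp: N_def)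
  also have "\<dots> = (\<Sum>j\<in>S. x j) + (\<Sum>j\<in>H. x j)" using sum.subset_diff[OF S_subset, of x] by simp
  also have "(\<Sum>j\<in>S. x j) \<le> (\<Sum>j\<in>S. 1)" using x(2) S_subset by (intro sum_mono) auto
  also have "\<dots> = real k" using card_S by simp
  also have "(\<Sum>j\<in>H. x j) \<le> (\<Sum>j\<in>N w. x j)"
    using fully_joined_S[OF full] w x(1) fin
    by (intro sum_mono2) (auto simp: N_def fully_joined_def V)
  also have "(\<Sum>j\<in>N w. x j) = \<rho> * x w" using eig_N w S_subset by auto
  finally have "\<rho> - real k \<le> \<rho> * x w" by simp
  then show ?thesis using \<rho>_gt by (simp add: field_simps)
qed

text \<open>The cross terms cancel. A pair in S weighs between q and 1, and there are at most k^2 of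
  them; all pairs in H together weigh at most 2cM \<epsilon>^2. Since q is close to 1, a surplus of
  one pair in S cannot be compensated.\<close>

lemma core_pairs_max:
  assumes full: "R = {}"
    and G': "verts G' = {..<n}" "fully_joined G' S"
    and le: "quad_form n (adj G') x \<le> \<rho> * (\<Sum>i<n. (x i)\<^sup>2)"
  shows "card (adj_pairs G' S) \<le> card (adj_pairs G S)"
proof (rule ccontr)
  assume "\<not> ?thesis"
  then have gt: "real (card (adj_pairs G S)) + 1 \<le> real (card (adj_pairs G' S))" by linarith
  define q where "q = (1 - real k / \<rho>)\<^sup>2"
  define t where "t = real (card (adj_pairs G S))"
  have q0: "1 - real k / \<rho> \<ge> 0" using \<rho>_gt by simp
  have q1: "q \<le> 1" unfolding q_def using q0 \<rho>_gt by (intro power_le_one) auto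
  have q00: "q \<ge> 0" by (simp add: q_def)
  have "block_form (adj G') S S x + 2 * block_form (adj G') S H x + block_form (adj G') H H x
     \<le> block_form (adj G) S S x + 2 * block_form (adj G) S H x + block_form (adj G) H H x"
    using le quad_form_eigen unfolding quad_form_eq_block_form
    by (simp only: block_form_split[OF S_subset adj_sym])
  moreover have "block_form (adj G') H H x \<ge> 0"
    unfolding block_form_def using x(1) adj_nonneg by (intro sum_nonneg) auto
  ultimately have b: "block_form (adj G') S S x \<le> block_form (adj G) S S x + block_form (adj G) H H x"
    unfolding block_form_fully_joined[OF G'(2,1)] block_form_fully_joined[OF fully_joined_S[OF full] V]
    by linarith
  have "block_form (adj G) H H x \<le> (\<Sum>i\<in>H. \<Sum>j\<in>H. \<epsilon>\<^sup>2 * adj G i j)"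
    unfolding block_form_def
  proof (intro sum_mono)
    fix i j assume ij: "i \<in> H" "j \<in> H"
    have "x i * x j \<le> \<epsilon> * \<epsilon>" using ij outside_S_le x(1) \<epsilon>_nonneg by (intro mult_mono) auto
    then have "adj G i j * (x i * x j) \<le> adj G i j * (\<epsilon> * \<epsilon>)" using adj_nonneg by (rule mult_left_mono)
    then show "adj G i j * x i * x j \<le> \<epsilon>\<^sup>2 * adj G i j" by (simp add: power2_eq_square mult_ac)
  qed
  also have "\<dots> = \<epsilon>\<^sup>2 * real (card (adj_pairs G H))"
    by (simp add: sum_distrib_left[symmetric] sum_adj_square)
  also have "\<dots> \<le> \<epsilon>\<^sup>2 * (2 * real c * real M)"
    using card_H_pairs[OF full] by (intro mult_left_mono) auto
  finally have h: "block_form (adj G) H H x \<le> 2 * real c * real M * \<epsilon>\<^sup>2" by (simp add: mult_ac)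
  have "block_form (adj G) S S x \<le> (\<Sum>i\<in>S. \<Sum>j\<in>S. adj G i j)"
    unfolding block_form_def
  proof (intro sum_mono)
    fix i j assume ij: "i \<in> S" "j \<in> S"
    have "x i * x j \<le> 1 * 1" using ij x S_subset by (intro mult_mono) auto
    then have "adj G i j * (x i * x j) \<le> adj G i j * (1 * 1)" using adj_nonneg by (rule mult_left_mono)
    then show "adj G i j * x i * x j \<le> adj G i j" by (simp add: mult_ac)
  qed
  then have t1: "block_form (adj G) S S x \<le> t" unfolding t_def using fin by (simp add: sum_adj_square)
  have "(\<Sum>i\<in>S. \<Sum>j\<in>S. q * adj G' i j) \<le> block_form (adj G') S S x"
    unfolding block_form_def
  proof (intro sum_mono)
    fix i j assume ij: "i \<in> S" "j \<in> S"
    have "q \<le> x i * x j" unfolding q_def power2_eq_square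
      using ij S_near_one[OF full] x(1) q0 by (intro mult_mono) auto
    then have "adj G' i j * q \<le> adj G' i j * (x i * x j)" using adj_nonneg by (rule mult_left_mono)
    then show "q * adj G' i j \<le> adj G' i j * x i * x j" by (simp add: mult_ac)
  qed
  then have "q * real (card (adj_pairs G' S)) \<le> block_form (adj G') S S x"
    using fin by (simp add: sum_distrib_left[symmetric] sum_adj_square)
  moreover have "q * (t + 1) \<le> q * real (card (adj_pairs G' S))"
    using gt q00 by (intro mult_left_mono) (auto simp: t_def)
  ultimately have c1: "q * (t + 1) \<le> t + 2 * real c * real M * \<epsilon>\<^sup>2" using b h t1 by linarith
  have "card (adj_pairs G S) \<le> card (S \<times> S)"
    using fin by (intro card_mono) (auto simp: adj_pairs_def)
  then have "card (adj_pairs G S) \<le> k * k" by (simp add: card_cartesian_product card_S)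
  then have "real (card (adj_pairs G S)) \<le> real (k * k)" by (rule of_nat_mono)
  then have "t \<le> (real k)\<^sup>2" by (simp add: t_def power2_eq_square)
  then have "t * (1 - q) \<le> (real k)\<^sup>2 * (1 - q)" using q1 by (intro mult_right_mono) auto
  moreover have "q - (real k)\<^sup>2 * (1 - q) - 2 * real c * real M * \<epsilon>\<^sup>2 > 0"
    using large unfolding large_def q_def by blast
  moreover have "q - t * (1 - q) \<le> 2 * real c * real M * \<epsilon>\<^sup>2"
    using c1 by (simp add: algebra_simps)
  ultimately show False by linarith
qed

text \<open>Only the pairs in H differ in weight. The eigenvalue equation puts all entries on H
  between \<sigma>/\<rho> and \<sigma>/(\<rho> - M), bounds whose ratio tends to 1. As the number of
  pairs of G in H is bounded by 2cM, one more pair would outweigh this variation.\<close>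

lemma outer_pairs_max:
  assumes full: "R = {}"
    and G': "verts G' = {..<n}" "fully_joined G' S"
    and same: "\<And>i j. i \<in> S \<Longrightarrow> j \<in> S \<Longrightarrow> {i, j} \<in> edges G' \<longleftrightarrow> {i, j} \<in> edges G"
    and le: "quad_form n (adj G') x \<le> \<rho> * (\<Sum>i<n. (x i)\<^sup>2)"
  shows "card (adj_pairs G' H) \<le> card (adj_pairs G H)"
proof (cases "H = {}")
  case True
  show ?thesis unfolding True by (simp add: adj_pairs_def)
next
  case False
  define \<sigma> where "\<sigma> = (\<Sum>i\<in>S. x i)"
  define Y where "Y = Max (x ` H)"
  have fH: "finite H" by simp
  have Yle: "x z \<le> Y" if "z \<in> H" for z unfolding Y_def using that by (intro Max_ge) auto
  obtain z where z: "z \<in> H" "x z = Y" using Max_in[of "x ` H"] False unfolding Y_def by fastforce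
  have Y0: "Y \<ge> 0" using z x(1) by metis
  have fj: "fully_joined G S" by (rule fully_joined_S[OF full])
  have split: "\<rho> * x v = \<sigma> + (\<Sum>u\<in>{u \<in> H. {v, u} \<in> edges G}. x u)" if v: "v \<in> H" for v
  proof -
    have "N v = S \<union> {u \<in> H. {v, u} \<in> edges G}"
      using fj v S_subset by (auto simp: N_def fully_joined_def V insert_commute)
    then have "(\<Sum>u\<in>N v. x u) = (\<Sum>u\<in>S \<union> {u \<in> H. {v, u} \<in> edges G}. x u)" by simp
    also have "\<dots> = \<sigma> + (\<Sum>u\<in>{u \<in> H. {v, u} \<in> edges G}. x u)"
      unfolding \<sigma>_def using fin by (intro sum.union_disjoint) auto
    finally show ?thesis using eig_N[of v] v by simp
  qed
  have low: "\<sigma> \<le> \<rho> * x v" if "v \<in> H" for v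
    using split[OF that] sum_nonneg[of "{u \<in> H. {v, u} \<in> edges G}" x] x(1) by simp
  have "(\<Sum>u\<in>{u \<in> H. {z, u} \<in> edges G}. x u) \<le> real (card {u \<in> H. {z, u} \<in> edges G}) * Y"
    using Yle by (intro sum_bounded_above) auto
  also have "\<dots> \<le> real M * Y" using H_degree[OF full z(1)] Y0 by (intro mult_right_mono) auto
  finally have up: "(\<rho> - real M) * Y \<le> \<sigma>" using split[OF z(1)] z(2) by (simp add: algebra_simps)
  obtain w where w: "w \<in> S" using card_S k by fastforce
  have "x w \<le> \<sigma>" unfolding \<sigma>_def using w fin x(1) by (intro member_le_sum) auto
  then have \<sigma>0: "\<sigma> > 0" using S_ge_half[OF w] by linarith
  show ?thesis
  proof (rule ccontr)
    assume "\<not> ?thesis"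
    then have gt: "real (card (adj_pairs G H)) + 1 \<le> real (card (adj_pairs G' H))" by linarith
    define h where "h = real (card (adj_pairs G H))"
    define h' where "h' = real (card (adj_pairs G' H))"
    have SS: "block_form (adj G') S S x = block_form (adj G) S S x"
      unfolding block_form_def using same by (intro sum.cong refl) (simp add: adj_def)
    have "block_form (adj G') S S x + 2 * block_form (adj G') S H x + block_form (adj G') H H x
       \<le> block_form (adj G) S S x + 2 * block_form (adj G) S H x + block_form (adj G) H H x"
      using le quad_form_eigen unfolding quad_form_eq_block_form
      by (simp only: block_form_split[OF S_subset adj_sym])
    then have b: "block_form (adj G') H H x \<le> block_form (adj G) H H x"
      unfolding SS block_form_fully_joined[OF G'(2,1)] block_form_fully_joined[OF fj V]
      by linarith
    have "block_form (adj G) H H x \<le> (\<Sum>i\<in>H. \<Sum>j\<in>H. Y\<^sup>2 * adj G i j)"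
      unfolding block_form_def
    proof (intro sum_mono)
      fix i j assume ij: "i \<in> H" "j \<in> H"
      have "x i * x j \<le> Y * Y" using ij Yle x(1) Y0 by (intro mult_mono) auto
      then have "adj G i j * (x i * x j) \<le> adj G i j * (Y * Y)" using adj_nonneg by (rule mult_left_mono)
      then show "adj G i j * x i * x j \<le> Y\<^sup>2 * adj G i j" by (simp add: power2_eq_square mult_ac)
    qed
    then have b1: "block_form (adj G) H H x \<le> Y\<^sup>2 * h"
      by (simp add: sum_distrib_left[symmetric] sum_adj_square h_def)
    have "(\<Sum>i\<in>H. \<Sum>j\<in>H. (\<sigma> / \<rho>)\<^sup>2 * adj G' i j) \<le> block_form (adj G') H H x"
      unfolding block_form_def
    proof (intro sum_mono)
      fix i j assume ij: "i \<in> H" "j \<in> H"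
      have "\<sigma> / \<rho> \<le> x v" if "v \<in> H" for v
        using low[OF that] \<rho>_gt by (simp add: divide_le_eq mult.commute)
      then have "(\<sigma> / \<rho>) * (\<sigma> / \<rho>) \<le> x i * x j"
        using ij \<sigma>0 \<rho>_gt x(1) by (intro mult_mono) auto
      then have "adj G' i j * ((\<sigma> / \<rho>) * (\<sigma> / \<rho>)) \<le> adj G' i j * (x i * x j)"
        using adj_nonneg by (rule mult_left_mono)
      then show "(\<sigma> / \<rho>)\<^sup>2 * adj G' i j \<le> adj G' i j * x i * x j" by (simp add: power2_eq_square mult_ac)
    qed
    then have b2: "(\<sigma> / \<rho>)\<^sup>2 * h' \<le> block_form (adj G') H H x"
      by (simp only: sum_distrib_left[symmetric] sum_adj_square[OF fH] h'_def)
    define a where "a = (\<rho> - real M)\<^sup>2"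
    have a0: "a \<ge> 0" by (simp add: a_def)
    have "a * Y\<^sup>2 \<le> \<sigma>\<^sup>2"
    proof -
      have "((\<rho> - real M) * Y)\<^sup>2 \<le> \<sigma>\<^sup>2" using up Y0 \<rho>_gt by (intro power_mono) auto
      then show ?thesis by (simp add: power_mult_distrib a_def)
    qed
    then have "a * Y\<^sup>2 * h \<le> \<sigma>\<^sup>2 * h" by (rule mult_right_mono) (simp add: h_def)
    moreover have "a * ((\<sigma> / \<rho>)\<^sup>2 * h') \<le> a * (Y\<^sup>2 * h)"
      using b b1 b2 a0 by (intro mult_left_mono) auto
    ultimately have "a * ((\<sigma> / \<rho>)\<^sup>2 * h') \<le> \<sigma>\<^sup>2 * h" by (simp add: mult.assoc)
    then have "\<sigma>\<^sup>2 * (a * h') \<le> \<sigma>\<^sup>2 * (h * \<rho>\<^sup>2)"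
      using \<rho>_gt by (simp add: field_simps)
    then have "a * h' \<le> h * \<rho>\<^sup>2" using \<sigma>0 by simp
    moreover have "a * (h + 1) \<le> a * h'" using gt a0 by (intro mult_left_mono) (auto simp: h_def h'_def)
    ultimately have "a \<le> h * (\<rho>\<^sup>2 - a)" by (simp add: algebra_simps)
    also have "\<dots> \<le> 2 * real c * real M * (\<rho>\<^sup>2 - a)"
    proof (intro mult_right_mono)
      show "h \<le> 2 * real c * real M" unfolding h_def by (rule card_H_pairs[OF full])
      have "a \<le> \<rho>\<^sup>2" unfolding a_def using \<rho>_gt by (intro power_mono) auto
      then show "0 \<le> \<rho>\<^sup>2 - a" by simp
    qed
    finally show False using large unfolding large_def a_def by linarith
  qed
qed

end

section \<open>Subgraph containment, matchings and relabellings\<close>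

lemma simple_graph_edgeE:
  assumes "fin_simple_graph G" "e \<in> edges G"
  obtains a b where "e = {a, b}" "a \<noteq> b" "a \<in> verts G" "b \<in> verts G"
  using assms unfolding fin_simple_graph_def by (metis card_2_iff insert_subset)

lemma finite_edges: "fin_simple_graph G \<Longrightarrow> finite (edges G)"
  by (rule finite_subset[of _ "Pow (verts G)"]) (auto simp: fin_simple_graph_def)

lemma common_nbrs_disjoint: "fin_simple_graph G \<Longrightarrow> common_nbrs G L \<inter> L = {}"
  using simple_graph_no_loop[of G] by (auto simp: common_nbrs_def)

text \<open>Send T to L and the other vertices to common neighbours of L. Every edge of F joins T to
  its complement, since T covers and is independent, so no other adjacency is required. This is the
  origin of the bound M.\<close>

lemma contains_of_common_nbrs:
  assumes F: "fin_simple_graph F" "covering F T" "independent_set F T"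
    and G: "fin_simple_graph G" "L \<subseteq> verts G" "card L = card T"
    and big: "card (verts F) \<le> card (common_nbrs G L)"
  shows "contains_subgraph G F"
proof -
  have fin: "finite (verts F)" "finite T" "finite L" "finite (common_nbrs G L)"
    using F G by (auto simp: fin_simple_graph_def covering_def common_nbrs_def intro: finite_subset)
  obtain g where g: "bij_betw g T L" using finite_same_card_bij[OF fin(2,3)] G(3) by auto
  have "card (verts F - T) \<le> card (common_nbrs G L)"
    using big card_mono[of "verts F" "verts F - T"] fin by auto
  then obtain h where h: "inj_on h (verts F - T)" "h ` (verts F - T) \<subseteq> common_nbrs G L"
    using card_le_inj[of "verts F - T" "common_nbrs G L"] fin by auto
  define f where "f v = (if v \<in> T then g v else h v)" for v
  have gL: "g v \<in> L" if "v \<in> T" for v using g that by (auto simp: bij_betw_def)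
  have hN: "h v \<in> common_nbrs G L" if "v \<in> verts F - T" for v using h that by auto
  have "inj_on f (verts F)"
  proof (rule inj_onI)
    fix u v assume uv: "u \<in> verts F" "v \<in> verts F" "f u = f v"
    have ne: "g a \<noteq> h b" if "a \<in> T" "b \<in> verts F - T" for a b
      using gL[OF that(1)] hN[OF that(2)] common_nbrs_disjoint[OF G(1), of L] by auto
    consider "u \<in> T" "v \<in> T" | "u \<in> T" "v \<notin> T" | "u \<notin> T" "v \<in> T" | "u \<notin> T" "v \<notin> T" by blast
    then show "u = v"
    proof cases
      case 1 then show ?thesis using uv bij_betw_imp_inj_on[OF g] by (simp add: f_def inj_on_eq_iff)
    next
      case 2 then show ?thesis using uv ne[of u v] by (simp add: f_def)
    next
      case 3 then show ?thesis using uv ne[of v u] by (simp add: f_def)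
    next
      case 4 then show ?thesis using uv h(1) by (simp add: f_def inj_on_eq_iff)
    qed
  qed
  moreover have "f ` verts F \<subseteq> verts G"
    using gL hN G(2) by (auto simp: f_def common_nbrs_def)
  moreover have "f ` e \<in> edges G" if e: "e \<in> edges F" for e
  proof -
    obtain a b where ab: "e = {a, b}" "a \<in> verts F" "b \<in> verts F"
      using simple_graph_edgeE[OF F(1) e] by metis
    have c: "a \<in> T \<or> b \<in> T" "\<not> (a \<in> T \<and> b \<in> T)"
      using F(2,3) e ab by (auto simp: covering_def independent_set_def)
    have edge: "{g u, h v} \<in> edges G" if "u \<in> T" "v \<in> verts F - T" for u v
      using gL[OF that(1)] hN[OF that(2)] by (auto simp: common_nbrs_def)
    show ?thesis
      using c edge[of a b] edge[of b a] ab by (auto simp: f_def insert_commute)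
  qed
  ultimately show ?thesis unfolding contains_subgraph_def by blast
qed

text \<open>Vertices of F placed in R are moved to common neighbours of S not yet used. The factor 2
  pays for the occupied places and for the new ones. The moved vertices had neighbours in S only, so
  their edges survive in G.\<close>

lemma contains_rejoin_imp:
  assumes F: "fin_simple_graph F"
    and G: "fin_simple_graph G" "S \<subseteq> verts G" "R \<subseteq> verts G - S"
    and big: "2 * card (verts F) \<le> card (common_nbrs G S)"
    and sub: "contains_subgraph (rejoin G S R) F"
  shows "contains_subgraph G F"
proof -
  obtain f where f: "inj_on f (verts F)" "f ` verts F \<subseteq> verts G"
    "\<And>e. e \<in> edges F \<Longrightarrow> f ` e \<in> edges (rejoin G S R)"
    using sub by (auto simp: contains_subgraph_def rejoin_def)
  have fin: "finite (verts F)" "finite (common_nbrs G S)"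
    using F G by (auto simp: fin_simple_graph_def common_nbrs_def)
  define X where "X = {v \<in> verts F. f v \<in> R}"
  have fX: "finite X" using fin by (simp add: X_def)
  have "card X \<le> card (verts F)" using fin by (intro card_mono) (auto simp: X_def)
  also have "\<dots> \<le> card (common_nbrs G S) - card (f ` verts F)"
    using big card_image_le[OF fin(1), of f] by linarith
  also have "\<dots> \<le> card (common_nbrs G S - f ` verts F)"
    using fin by (intro diff_card_le_card_Diff) auto
  finally have "card X \<le> card (common_nbrs G S - f ` verts F)" .
  then obtain h where h: "inj_on h X" "h ` X \<subseteq> common_nbrs G S - f ` verts F"
    using card_le_inj[OF fX, of "common_nbrs G S - f ` verts F"] fin by auto
  define f' where "f' v = (if v \<in> X then h v else f v)" for v
  have hN: "h v \<in> common_nbrs G S" "h v \<notin> f ` verts F" if "v \<in> X" for v using h that by auto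
  have "inj_on f' (verts F)"
  proof (rule inj_onI)
    fix u v assume uv: "u \<in> verts F" "v \<in> verts F" "f' u = f' v"
    consider "u \<in> X" "v \<in> X" | "u \<in> X" "v \<notin> X" | "u \<notin> X" "v \<in> X" | "u \<notin> X" "v \<notin> X" by blast
    then show "u = v"
    proof cases
      case 1 then show ?thesis using uv h(1) by (simp add: f'_def inj_on_eq_iff)
    next
      case 2 then show ?thesis using uv hN(2)[of u] by (auto simp: f'_def)
    next
      case 3 then show ?thesis using uv hN(2)[of v] by (metis f'_def imageI)
    next
      case 4 then show ?thesis using uv f(1) by (simp add: f'_def inj_on_eq_iff)
    qed
  qed
  moreover have "f' ` verts F \<subseteq> verts G"
    using hN f(2) by (auto simp: f'_def common_nbrs_def)
  moreover have "f' ` e \<in> edges G" if e: "e \<in> edges F" for e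
  proof -
    obtain a b where ab: "e = {a, b}" "a \<in> verts F" "b \<in> verts F"
      using simple_graph_edgeE[OF F(1) e] by metis
    have edge: "{f' u, f' v} \<in> edges G" if "u \<in> verts F" "v \<in> verts F" "f u \<in> S" "f v \<in> R" for u v
    proof -
      have "u \<notin> X" "v \<in> X" using that G(3) by (auto simp: X_def)
      then show ?thesis using hN(1)[of v] that by (auto simp: f'_def common_nbrs_def)
    qed
    have "{f a, f b} \<in> edges (rejoin G S R)" using f(3)[OF e] ab by simp
    then consider "{f a, f b} \<in> edges G" "{f a, f b} \<inter> R = {}"
      | w v where "{f a, f b} = {w, v}" "w \<in> S" "v \<in> R"
      by (auto simp: rejoin_def)
    then show ?thesis
    proof cases
      case 1
      then show ?thesis using ab by (auto simp: f'_def X_def)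
    next
      case (2 w v)
      then show ?thesis
        using edge[of a b] edge[of b a] ab by (auto simp: doubleton_eq_iff insert_commute)
    qed
  qed
  ultimately show ?thesis unfolding contains_subgraph_def by blast
qed

lemma fin_simple_graph_rejoin:
  assumes G: "fin_simple_graph G" "S \<subseteq> verts G" "R \<subseteq> verts G - S"
  shows "fin_simple_graph (rejoin G S R)"
proof -
  have "card {w, v} = 2" if "w \<in> S" "v \<in> R" for w v
  proof -
    have "w \<noteq> v" using that G(3) by auto
    then show ?thesis by simp
  qed
  then show ?thesis using G unfolding fin_simple_graph_def rejoin_def by auto
qed

text \<open>A join with an edgeless graph, realised on the labels \<open>{..<n}\<close> with its
  core at a prescribed place S, so that it can belong to \<open>free_graphs n Fs\<close>.\<close>

definition core_join :: "nat \<Rightarrow> nat set \<Rightarrow> nat set set \<Rightarrow> nat ugraph" where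
  "core_join n S A =
     \<lparr>verts = {..<n}, edges = A \<union> {{w, v} | w v. w \<in> S \<and> v \<in> {..<n} - S}\<rparr>"

lemma verts_core_join: "verts (core_join n S A) = {..<n}"
  by (simp add: core_join_def)

lemma fin_simple_graph_core_join:
  assumes "S \<subseteq> {..<n}" "\<And>e. e \<in> A \<Longrightarrow> e \<subseteq> S \<and> card e = 2"
  shows "fin_simple_graph (core_join n S A)"
proof -
  have "card {w, v} = 2" if "w \<in> S" "v \<in> {..<n} - S" for w v
  proof -
    have "w \<noteq> v" using that by auto
    then show ?thesis by simp
  qed
  moreover have "e \<subseteq> {..<n}" if "e \<in> A" for e using assms that by blast
  ultimately show ?thesis using assms unfolding fin_simple_graph_def core_join_def by auto
qed

lemma fully_joined_core_join: "fully_joined (core_join n S A) S"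
  by (auto simp: fully_joined_def core_join_def)

text \<open>T is the preimage of S. It is a covering because no edge runs outside S, and its induced
  subgraph lands in the core. This is how coverings of F arise from containment in a join.\<close>

lemma contains_core_joinE:
  assumes F: "fin_simple_graph F" and sub: "contains_subgraph (core_join n S A) F"
    and S: "finite S" and A: "A \<subseteq> Pow S"
  obtains T f where "covering F T" "card T \<le> card S" "inj_on f T" "f ` T \<subseteq> S"
    "\<forall>e\<in>edges F. e \<subseteq> T \<longrightarrow> f ` e \<in> A"
proof -
  obtain f where f: "inj_on f (verts F)"
    "\<And>e. e \<in> edges F \<Longrightarrow> f ` e \<in> edges (core_join n S A)"
    using sub by (auto simp: contains_subgraph_def)
  define T where "T = {v \<in> verts F. f v \<in> S}"
  have TF: "T \<subseteq> verts F" by (auto simp: T_def)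
  have inj: "inj_on f T" using f(1) TF by (rule inj_on_subset)
  have fT: "f ` T \<subseteq> S" by (auto simp: T_def)
  have "covering F T"
    unfolding covering_def
  proof (intro conjI ballI TF)
    fix e assume e: "e \<in> edges F"
    obtain a b where ab: "e = {a, b}" "a \<in> verts F" "b \<in> verts F"
      using simple_graph_edgeE[OF F(1) e] by metis
    have "{f a, f b} \<in> edges (core_join n S A)" using f(2)[OF e] ab by simp
    then have "f a \<in> S \<or> f b \<in> S" using A by (fastforce simp: core_join_def doubleton_eq_iff)
    then show "e \<inter> T \<noteq> {}" using ab by (auto simp: T_def)
  qed
  moreover have "card T \<le> card S" using card_inj_on_le[OF inj fT S] .
  moreover have "f ` e \<in> A" if e: "e \<in> edges F" "e \<subseteq> T" for e
  proof -
    have "f ` e \<subseteq> S" using e by (auto simp: T_def)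
    moreover have "f ` e \<in> edges (core_join n S A)" using f(2) e by auto
    ultimately show ?thesis by (auto simp: core_join_def)
  qed
  ultimately show ?thesis using inj fT that by blast
qed

section \<open>Matchings and covers\<close>

lemma matching_graph_simple: "fin_simple_graph (matching_graph m)"
  by (auto simp: fin_simple_graph_def matching_graph_def)

lemma contains_matching_graph:
  assumes G: "fin_simple_graph G" and Mt: "Mt \<subseteq> edges G" "disjoint Mt" "card Mt = m" "finite Mt"
  shows "contains_subgraph G (matching_graph m)"
proof -
  obtain e where e: "bij_betw e {..<m} Mt"
    using finite_same_card_bij[of "{..<m}" Mt] Mt by auto
  have eM: "e i \<in> Mt" if "i < m" for i using e that by (auto simp: bij_betw_def)
  have "\<exists>a b. e i = {a, b} \<and> a \<noteq> b \<and> a \<in> verts G \<and> b \<in> verts G" if "i < m" for i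
    using simple_graph_edgeE[OF G, of "e i"] eM[OF that] Mt(1) by (metis subsetD)
  then obtain a b where ab: "\<And>i. i < m \<Longrightarrow> e i = {a i, b i} \<and> a i \<noteq> b i \<and> a i \<in> verts G \<and> b i \<in> verts G"
    by metis
  have dis: "i = j" if "i < m" "j < m" "z \<in> e i" "z \<in> e j" for i j z
  proof (rule ccontr)
    assume "i \<noteq> j"
    then have "e i \<noteq> e j" using e that by (auto simp: bij_betw_def inj_on_def)
    then show False using disjointD[OF Mt(2) eM[OF that(1)] eM[OF that(2)]] that by blast
  qed
  define f where "f v = (if even v then a (v div 2) else b (v div 2))" for v :: nat
  have fe: "f v \<in> e (v div 2)" if "v < 2 * m" for v
  proof -
    have "v div 2 < m" using that by auto
    then show ?thesis using ab by (simp add: f_def)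
  qed
  have "inj_on f {..<2 * m}"
  proof (rule inj_onI)
    fix u v assume uv: "u \<in> {..<2 * m}" "v \<in> {..<2 * m}" "f u = f v"
    have h: "u div 2 < m" "v div 2 < m" using uv by auto
    have eq: "u div 2 = v div 2" using dis[OF h] fe uv by (metis lessThan_iff)
    have "even u \<longleftrightarrow> even v" using uv(3) ab[OF h(1)] eq by (auto simp: f_def split: if_splits)
    then show "u = v" using eq by (metis dvd_mult_div_cancel odd_two_times_div_two_succ)
  qed
  moreover have "f ` {..<2 * m} \<subseteq> verts G"
  proof
    fix y assume "y \<in> f ` {..<2 * m}"
    then obtain v where v: "v < 2 * m" "y = f v" by auto
    then have "v div 2 < m" by auto
    then show "y \<in> verts G" using ab v by (simp add: f_def)
  qed
  moreover have "f ` {2 * i, 2 * i + 1} \<in> edges G" if "i < m" for i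
  proof -
    have "f ` {2 * i, 2 * i + 1} = e i" using ab[OF that] by (auto simp: f_def)
    then show ?thesis using eM[OF that] Mt(1) by auto
  qed
  ultimately show ?thesis
    unfolding contains_subgraph_def matching_graph_def by (intro exI[of _ f]) auto
qed

text \<open>The ends of a maximum matching meet every edge, since otherwise the matching could be
  enlarged.\<close>

lemma small_cover_of_matching_free:
  assumes G: "fin_simple_graph G" and free: "\<not> contains_subgraph G (matching_graph (Suc s))"
  obtains C where "C \<subseteq> verts G" "card C \<le> 2 * s" "\<And>e. e \<in> edges G \<Longrightarrow> e \<inter> C \<noteq> {}"
proof -
  define \<M> where "\<M> = {Mt. Mt \<subseteq> edges G \<and> disjoint Mt}"
  have fE: "finite (edges G)" by (rule finite_edges[OF G])
  have fM: "finite \<M>" using fE by (simp add: \<M>_def)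
  have "{} \<in> \<M>" by (simp add: \<M>_def)
  then have "Max (card ` \<M>) \<in> card ` \<M>" using fM by (intro Max_in) auto
  then obtain Mt where Mt: "Mt \<in> \<M>" "Max (card ` \<M>) = card Mt" by auto
  have max: "card X \<le> card Mt" if "X \<in> \<M>" for X
    unfolding Mt(2)[symmetric] using fM that by (intro Max_ge) auto
  have fMt: "finite Mt" using Mt fE by (auto simp: \<M>_def intro: finite_subset)
  have cM: "card Mt \<le> s"
  proof (rule ccontr)
    assume "\<not> card Mt \<le> s"
    then obtain X where X: "X \<subseteq> Mt" "card X = Suc s" by (meson not_less_eq_eq obtain_subset_with_card_n)
    then have "contains_subgraph G (matching_graph (Suc s))"
      using Mt(1) fMt pairwise_subset[of disjnt Mt X]
      by (intro contains_matching_graph[OF G, of X]) (auto simp: \<M>_def intro: finite_subset)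
    then show False using free by simp
  qed
  show ?thesis
  proof
    show "\<Union> Mt \<subseteq> verts G" using Mt G by (auto simp: \<M>_def fin_simple_graph_def)
    have "card (\<Union> Mt) \<le> (\<Sum>e\<in>Mt. card e)" by (rule card_Union_le_sum_card)
    also have "\<dots> = (\<Sum>e\<in>Mt. 2)"
      using Mt G by (intro sum.cong) (auto simp: \<M>_def fin_simple_graph_def)
    finally show "card (\<Union> Mt) \<le> 2 * s" using cM by simp
    fix e assume e: "e \<in> edges G"
    show "e \<inter> \<Union> Mt \<noteq> {}"
    proof
      assume d: "e \<inter> \<Union> Mt = {}"
      have "e \<noteq> {}" using e G by (auto simp: fin_simple_graph_def)
      then have "e \<notin> Mt" using d by auto
      moreover have "insert e Mt \<in> \<M>" using Mt(1) e d by (auto simp: \<M>_def disjoint_def)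
      ultimately show False using max[of "insert e Mt"] fMt by simp
    qed
  qed
qed

text \<open>Choose private neighbours for the vertices of S greedily, avoiding S, e and the earlier
  choices. At most |S| + 2 + (|S| - 1) vertices are blocked at each turn, fewer than the degree. The
  edge e completes the matching.\<close>

lemma contains_matching_of_large_degrees:
  assumes G: "fin_simple_graph G" and S: "finite S" "S \<subseteq> verts G"
    and deg: "\<And>w. w \<in> S \<Longrightarrow> card {u \<in> verts G. {w, u} \<in> edges G} \<ge> 2 * card S + 2"
    and e: "e \<in> edges G" "e \<inter> S = {}"
  shows "contains_subgraph G (matching_graph (Suc (card S)))"
proof -
  have fe: "finite e" "card e = 2"
    using e G by (auto simp: fin_simple_graph_def intro: finite_subset)
  have "W \<subseteq> S \<Longrightarrow> \<exists>f. inj_on f W \<and> (\<forall>w\<in>W. {w, f w} \<in> edges G \<and> f w \<notin> S \<union> e)" if "finite W" for W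
    using that
  proof (induction W rule: finite_induct)
    case (insert w W)
    then obtain f where f: "inj_on f W" "\<forall>w\<in>W. {w, f w} \<in> edges G \<and> f w \<notin> S \<union> e" by auto
    let ?N = "{u \<in> verts G. {w, u} \<in> edges G}"
    have cW: "card W < card S"
      using insert.prems insert.hyps S(1) by (intro psubset_card_mono) auto
    have "card (S \<union> e \<union> f ` W) \<le> card S + 2 + card W"
      using card_Un_le[of "S \<union> e" "f ` W"] card_Un_le[of S e] card_image_le[OF insert.hyps(1), of f] fe
      by linarith
    also have "\<dots> < card ?N" using deg[of w] insert.prems cW by auto
    finally have "\<not> ?N \<subseteq> S \<union> e \<union> f ` W"
      using card_mono[of "S \<union> e \<union> f ` W" ?N] S(1) fe insert.hyps(1) by fastforce
    then obtain u where u: "{w, u} \<in> edges G" "u \<notin> S \<union> e \<union> f ` W" by auto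
    have "inj_on (f(w := u)) (insert w W)"
      using f(1) insert.hyps u by (auto simp: inj_on_def)
    moreover have "\<forall>v\<in>insert w W. {v, (f(w := u)) v} \<in> edges G \<and> (f(w := u)) v \<notin> S \<union> e"
      using f u insert.hyps by auto
    ultimately show ?case by blast
  qed simp
  from this[OF S(1)] obtain f where f: "inj_on f S" "\<And>w. w \<in> S \<Longrightarrow> {w, f w} \<in> edges G"
    "\<And>w. w \<in> S \<Longrightarrow> f w \<notin> S \<union> e" by auto
  define Mt where "Mt = insert e ((\<lambda>w. {w, f w}) ` S)"
  have "inj_on (\<lambda>w. {w, f w}) S"
    using f(3) by (auto simp: inj_on_def doubleton_eq_iff)
  moreover have "e \<notin> (\<lambda>w. {w, f w}) ` S" using e(2) by auto
  ultimately have "card Mt = Suc (card S)" using S(1) by (simp add: Mt_def card_image)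
  moreover have "disjoint Mt"
  proof (rule disjointI)
    have disj: "{w, f w} \<inter> {v, f v} = {}" if "w \<in> S" "v \<in> S" "w \<noteq> v" for w v
      using that f by (auto dest: inj_onD)
    have disj_e: "e \<inter> {w, f w} = {}" if "w \<in> S" for w using that e(2) f(3) by auto
    fix a b assume ab: "a \<in> Mt" "b \<in> Mt" "a \<noteq> b"
    consider "a = e" "b = e" | w where "a = e" "w \<in> S" "b = {w, f w}"
      | w where "b = e" "w \<in> S" "a = {w, f w}"
      | w v where "w \<in> S" "v \<in> S" "a = {w, f w}" "b = {v, f v}"
      using ab(1,2) unfolding Mt_def by blast
    then show "a \<inter> b = {}"
    proof cases
      case 1 then show ?thesis using ab(3) by simp
    next
      case (2 w) then show ?thesis using disj_e[of w] by simp
    next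
      case (3 w) then show ?thesis using disj_e[of w] by blast
    next
      case (4 w v)
      then have "w \<noteq> v" using ab(3) by auto
      then show ?thesis using disj[OF 4(1,2)] 4(3,4) by simp
    qed
  qed
  ultimately show ?thesis
    using f(2) e(1) S(1) by (intro contains_matching_graph[OF G, of Mt]) (auto simp: Mt_def)
qed

section \<open>Relabelling and edge counts\<close>

definition relabel :: "('a \<Rightarrow> 'b) \<Rightarrow> 'a ugraph \<Rightarrow> 'b ugraph" where
  "relabel \<psi> G = \<lparr>verts = \<psi> ` verts G, edges = (\<lambda>e. \<psi> ` e) ` edges G\<rparr>"

lemma contains_relabel_imp:
  assumes "fin_simple_graph G" "inj_on \<psi> (verts G)" "contains_subgraph (relabel \<psi> G) F"
  shows "contains_subgraph G F"
proof -
  obtain f where f: "inj_on f (verts F)" "f ` verts F \<subseteq> \<psi> ` verts G"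
    "\<And>e. e \<in> edges F \<Longrightarrow> f ` e \<in> (\<lambda>e. \<psi> ` e) ` edges G"
    using assms(3) by (auto simp: contains_subgraph_def relabel_def)
  let ?g = "inv_into (verts G) \<psi> \<circ> f"
  have "inj_on ?g (verts F)"
    using f by (intro comp_inj_on inj_on_inv_into)
  moreover have "?g ` verts F \<subseteq> verts G" using f(2) by (auto intro!: inv_into_into)
  moreover have "?g ` e \<in> edges G" if e: "e \<in> edges F" for e
  proof -
    obtain e' where e': "e' \<in> edges G" "f ` e = \<psi> ` e'" using f(3)[OF e] by auto
    have "e' \<subseteq> verts G" using e' assms(1) by (auto simp: fin_simple_graph_def)
    then have "?g ` e = e'" using inv_into_image_cancel[OF assms(2)]
      unfolding image_comp[symmetric] e'(2) by simp
    then show ?thesis using e' by simp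
  qed
  ultimately show ?thesis unfolding contains_subgraph_def by blast
qed

lemma fin_simple_graph_relabel:
  assumes "fin_simple_graph G" "inj_on \<psi> (verts G)"
  shows "fin_simple_graph (relabel \<psi> G)"
proof -
  have "card (\<psi> ` e) = 2" if "e \<in> edges G" for e
    using that assms by (subst card_image) (auto simp: fin_simple_graph_def intro: inj_on_subset)
  then show ?thesis using assms by (auto simp: fin_simple_graph_def relabel_def)
qed

lemma card_edges_relabel:
  assumes "fin_simple_graph G" "inj_on \<psi> (verts G)"
  shows "card (edges (relabel \<psi> G)) = card (edges G)"
proof -
  have "inj_on (\<lambda>e. \<psi> ` e) (edges G)"
    using assms(1)
    by (intro inj_on_subset[OF inj_on_image_Pow[OF assms(2)]]) (auto simp: fin_simple_graph_def)
  then show ?thesis by (simp add: relabel_def card_image)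
qed

lemma relabel_free:
  assumes "G \<in> free_graphs n Fs" "bij_betw \<psi> {..<n} {..<n}"
  shows "relabel \<psi> G \<in> free_graphs n Fs"
proof -
  have G: "fin_simple_graph G" "verts G = {..<n}" "inj_on \<psi> (verts G)"
    using assms by (auto simp: free_graphs_def bij_betw_def)
  have "\<not> contains_subgraph (relabel \<psi> G) F" if "F \<in> Fs" for F
    using that assms(1) contains_relabel_imp[OF G(1,3), of F] by (auto simp: free_graphs_def)
  moreover have "verts (relabel \<psi> G) = {..<n}"
    using G(2) assms(2) by (simp add: relabel_def bij_betw_def)
  ultimately show ?thesis
    using fin_simple_graph_relabel[OF G(1,3)] by (simp add: free_graphs_def)
qed

lemma card_adj_pairs:
  assumes G: "fin_simple_graph G"
  shows "card (adj_pairs G (verts G)) = 2 * card (edges G)"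
proof -
  have "adj_pairs G (verts G) = (\<Union>e\<in>edges G. {(i, j). {i, j} = e})"
    using simple_graph_edge_verts[OF G] by (auto simp: adj_pairs_def)
  also have "card \<dots> = (\<Sum>e\<in>edges G. card {(i, j). {i, j} = e})"
  proof (rule card_UN_disjoint)
    show "finite (edges G)" by (rule finite_edges[OF G])
    show "\<forall>e\<in>edges G. finite {(i, j). {i, j} = e}"
    proof
      fix e assume "e \<in> edges G"
      then have "card e = 2" using G by (simp add: fin_simple_graph_def)
      then have "finite e" by (intro card_ge_0_finite) simp
      moreover have "{(i, j). {i, j} = e} \<subseteq> e \<times> e" by auto
      ultimately show "finite {(i, j). {i, j} = e}" using finite_subset by blast
    qed
  qed auto
  also have "\<dots> = (\<Sum>e\<in>edges G. 2)"
  proof (intro sum.cong refl)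
    fix e assume "e \<in> edges G"
    then obtain a b where ab: "e = {a, b}" "a \<noteq> b" using simple_graph_edgeE[OF G] by metis
    then have "{(i, j). {i, j} = e} = {(a, b), (b, a)}" by (auto simp: doubleton_eq_iff)
    then show "card {(i, j). {i, j} = e} = 2" using ab by simp
  qed
  finally show ?thesis by simp
qed

lemma card_edges_split:
  assumes G: "fin_simple_graph G" "verts G = {..<n}" and S: "S \<subseteq> {..<n}"
  shows "2 * real (card (edges G)) = real (card (adj_pairs G S))
    + 2 * (\<Sum>i\<in>S. \<Sum>j\<in>{..<n} - S. adj G i j) + real (card (adj_pairs G ({..<n} - S)))"
proof -
  have fS: "finite S" using S finite_subset by blast
  have "2 * real (card (edges G)) = real (card (adj_pairs G {..<n}))"
    using card_adj_pairs[OF G(1)] G(2) by simp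
  \<comment> \<open>At the all-ones vector the block decomposition of the quadratic form becomes a
    decomposition of the edge count.\<close>
  also have "\<dots> = block_form (adj G) {..<n} {..<n} (\<lambda>_. 1)"
    by (simp add: block_form_def sum_adj_square)
  also have "\<dots> = block_form (adj G) S S (\<lambda>_. 1) + 2 * block_form (adj G) S ({..<n} - S) (\<lambda>_. 1)
      + block_form (adj G) ({..<n} - S) ({..<n} - S) (\<lambda>_. 1)"
    by (rule block_form_split[OF S adj_sym])
  finally show ?thesis using fS by (simp add: block_form_def sum_adj_square)
qed

lemma card_edges_fully_joined:
  assumes G: "fin_simple_graph G" "verts G = {..<n}" and S: "S \<subseteq> {..<n}" "fully_joined G S"
  shows "2 * real (card (edges G)) = real (card (adj_pairs G S))
    + 2 * (real (card S) * real (n - card S)) + real (card (adj_pairs G ({..<n} - S)))"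
proof -
  have "finite S" using S finite_subset by blast
  then have "card ({..<n} - S) = n - card S" using S(1) by (simp add: card_Diff_subset)
  moreover have "(\<Sum>i\<in>S. \<Sum>j\<in>{..<n} - S. adj G i j) = real (card S) * real (card ({..<n} - S))"
    using block_form_fully_joined[OF S(2) G(2), of "\<lambda>_. 1"] by (simp add: block_form_def)
  ultimately show ?thesis using card_edges_split[OF G S(1)] by simp
qed

lemma card_adj_pairs_image:
  assumes "inj_on g X" "\<And>i j. i \<in> X \<Longrightarrow> j \<in> X \<Longrightarrow> {g i, g j} \<in> edges G' \<longleftrightarrow> {i, j} \<in> edges G"
  shows "card (adj_pairs G' (g ` X)) = card (adj_pairs G X)"
proof -
  have "adj_pairs G' (g ` X) = map_prod g g ` adj_pairs G X"
    using assms(2) by (auto simp: adj_pairs_def image_iff)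
  moreover have "inj_on (map_prod g g) (adj_pairs G X)"
    using assms(1) by (auto simp: adj_pairs_def inj_on_def)
  ultimately show ?thesis by (simp add: card_image)
qed

lemma relabel_edge_iff:
  assumes "fin_simple_graph G" "inj_on \<psi> (verts G)" "i \<in> verts G" "j \<in> verts G"
  shows "{\<psi> i, \<psi> j} \<in> edges (relabel \<psi> G) \<longleftrightarrow> {i, j} \<in> edges G"
proof
  assume "{\<psi> i, \<psi> j} \<in> edges (relabel \<psi> G)"
  then obtain e where e: "e \<in> edges G" "\<psi> ` {i, j} = \<psi> ` e" by (auto simp: relabel_def)
  have "e \<subseteq> verts G" using e assms(1) by (auto simp: fin_simple_graph_def)
  then have "{i, j} = e" using inj_on_image_eq_iff[OF assms(2), of "{i, j}" e] e(2) assms(3,4) by simp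
  then show "{i, j} \<in> edges G" using e by simp
qed (auto simp: relabel_def image_iff intro!: bexI[of _ "{i, j}"])

lemma card_adj_pairs_relabel:
  assumes "fin_simple_graph G" "inj_on \<psi> (verts G)" "S \<subseteq> verts G"
  shows "card (adj_pairs (relabel \<psi> G) (\<psi> ` S)) = card (adj_pairs G S)"
  using assms by (intro card_adj_pairs_image relabel_edge_iff) (auto intro: inj_on_subset)

lemma fully_joined_relabel:
  assumes "fin_simple_graph G" "inj_on \<psi> (verts G)" "S \<subseteq> verts G" "fully_joined G S"
  shows "fully_joined (relabel \<psi> G) (\<psi> ` S)"
  unfolding fully_joined_def
proof (intro ballI)
  fix w v assume "w \<in> \<psi> ` S" "v \<in> verts (relabel \<psi> G) - \<psi> ` S"
  then obtain i j where "i \<in> S" "w = \<psi> i" "j \<in> verts G - S" "v = \<psi> j" by (auto simp: relabel_def)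
  then show "{w, v} \<in> edges (relabel \<psi> G)"
    using assms relabel_edge_iff[OF assms(1,2), of i j] by (auto simp: fully_joined_def)
qed

lemma extend_bij:
  assumes S: "S \<subseteq> V" "S' \<subseteq> V" and V: "finite V" and g: "bij_betw g S' S"
  obtains \<psi> where "bij_betw \<psi> V V" "\<And>i. i \<in> S' \<Longrightarrow> \<psi> i = g i"
proof -
  have fin: "finite S" "finite S'" using S V finite_subset by blast+
  have "card S' = card S" using g by (rule bij_betw_same_card)
  then have "card (V - S') = card (V - S)" using S fin by (simp add: card_Diff_subset)
  then obtain h where h: "bij_betw h (V - S') (V - S)"
    using finite_same_card_bij[of "V - S'" "V - S"] V by auto
  define \<psi> where "\<psi> i = (if i \<in> S' then g i else h i)" for i
  have "bij_betw \<psi> S' S" using g by (rule bij_betw_cong[THEN iffD1, rotated]) (simp add: \<psi>_def)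
  moreover have "bij_betw \<psi> (V - S') (V - S)"
    using h by (rule bij_betw_cong[THEN iffD1, rotated]) (simp add: \<psi>_def)
  ultimately have "bij_betw \<psi> (S' \<union> (V - S')) (S \<union> (V - S))" by (rule bij_betw_combine) auto
  moreover have "S' \<union> (V - S') = V" "S \<union> (V - S) = V" using S by auto
  ultimately have "bij_betw \<psi> V V" by simp
  then show thesis by (rule that) (simp add: \<psi>_def)
qed

lemma card_edges_le_sum_degrees:
  assumes G: "fin_simple_graph G" and C: "finite C" "\<And>e. e \<in> edges G \<Longrightarrow> e \<inter> C \<noteq> {}"
  shows "card (edges G) \<le> (\<Sum>w\<in>C. card {u \<in> verts G. {w, u} \<in> edges G})"
proof -
  have "edges G \<subseteq> (\<Union>w\<in>C. (\<lambda>u. {w, u}) ` {u \<in> verts G. {w, u} \<in> edges G})"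
  proof
    fix e assume e: "e \<in> edges G"
    obtain a b where ab: "e = {a, b}" "a \<in> verts G" "b \<in> verts G"
      using simple_graph_edgeE[OF G e] by metis
    have "a \<in> C \<or> b \<in> C" using C(2)[OF e] ab by auto
    then show "e \<in> (\<Union>w\<in>C. (\<lambda>u. {w, u}) ` {u \<in> verts G. {w, u} \<in> edges G})"
    proof
      assume "a \<in> C" then show ?thesis using ab e by auto
    next
      assume "b \<in> C"
      moreover have "e = {b, a}" using ab by auto
      ultimately show ?thesis using ab e by blast
    qed
  qed
  moreover have fV: "finite (verts G)" using G by (simp add: fin_simple_graph_def)
  ultimately have "card (edges G) \<le> card (\<Union>w\<in>C. (\<lambda>u. {w, u}) ` {u \<in> verts G. {w, u} \<in> edges G})"
    using C(1) by (intro card_mono) auto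
  also have "\<dots> \<le> (\<Sum>w\<in>C. card ((\<lambda>u. {w, u}) ` {u \<in> verts G. {w, u} \<in> edges G}))"
    using C(1) by (rule card_UN_le)
  also have "\<dots> \<le> (\<Sum>w\<in>C. card {u \<in> verts G. {w, u} \<in> edges G})"
    using fV by (intro sum_mono card_image_le) auto
  finally show ?thesis .
qed

section \<open>Spectrally extremal graphs of a forbidden family\<close>

lemma Inf_enat_in: "A \<noteq> {} \<Longrightarrow> Inf A \<in> (A :: enat set)"
  unfolding Inf_enat_def by (auto intro: LeastI)

lemma adjacency_matrix_adj: "adjacency_matrix n G = mat n n (\<lambda>(i, j). complex_of_real (adj G i j))"
  unfolding adjacency_matrix_def by (rule eq_matI) (auto simp: adj_def)

lemma
  assumes "n > 0"
  shows rayleigh_le_spectral_radius: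
      "quad_form n (adj G) y \<le> spectral_radius (adjacency_matrix n G) * (\<Sum>i<n. (y i)\<^sup>2)"
    and perron_vector_exists:
      "\<exists>x. (\<forall>i. x i \<ge> 0) \<and> (\<Sum>i<n. (x i)\<^sup>2) = 1 \<and>
        (\<forall>i<n. (\<Sum>j<n. adj G i j * x j) = spectral_radius (adjacency_matrix n G) * x i)"
  using spectral_radius_symmetric_nonneg[OF assms, of "adj G" "spectral_radius (adjacency_matrix n G)"]
  by (auto simp: adjacency_matrix_adj adj_nonneg adj_sym)

text \<open>k is the size of the core, one less than the independent covering number of the family.
  Part (1) is the instance k = s.\<close>

locale forbidden_family =
  fixes Fs :: "nat ugraph set" and s k :: nat
  assumes finite_Fs: "finite Fs"
    and simple: "\<And>F. F \<in> Fs \<Longrightarrow> fin_simple_graph F"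
    and matching: "matching_graph (Suc s) \<in> Fs"
    and k: "k \<ge> 1"
    and indep_cover: "fam_indep_cover_num Fs = enat (Suc k)"
begin

lemma indep_cover_witness:
  obtains F T where "F \<in> Fs" "covering F T" "independent_set F T" "card T = Suc k"
proof -
  have "fam_indep_cover_num Fs \<in> indep_cover_num ` Fs"
    unfolding fam_indep_cover_num_def using matching by (intro Inf_enat_in) auto
  then obtain F where F: "F \<in> Fs" "indep_cover_num F = enat (Suc k)" using indep_cover by auto
  let ?A = "(\<lambda>S. enat (card S)) ` {S. covering F S \<and> independent_set F S}"
  have "?A \<noteq> {}"
  proof
    assume "?A = {}"
    then have "indep_cover_num F = \<infinity>" unfolding indep_cover_num_def by (simp only: Inf_enat_def) simp
    then show False using F by simp
  qed
  then have "indep_cover_num F \<in> ?A" unfolding indep_cover_num_def by (rule Inf_enat_in)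
  then show ?thesis using F that by auto
qed

lemma indep_cover_ge:
  assumes "F \<in> Fs" "covering F T" "independent_set F T"
  shows "Suc k \<le> card T"
proof -
  have "fam_indep_cover_num Fs \<le> indep_cover_num F"
    unfolding fam_indep_cover_num_def using assms(1) by (rule INF_lower)
  also have "\<dots> \<le> enat (card T)"
    unfolding indep_cover_num_def using assms by (intro INF_lower) auto
  finally show ?thesis using indep_cover by simp
qed

text \<open>An embedding of F would yield a covering of F with at most k vertices. As the core has
  no edges, this covering is independent, which contradicts the minimality of k + 1.\<close>

lemma bipartite_free:
  assumes "S \<subseteq> {..<n}" "card S = k"
  shows "core_join n S {} \<in> free_graphs n Fs"
proof -
  have fS: "finite S" using assms finite_subset by blast
  have "\<not> contains_subgraph (core_join n S {}) F" if F: "F \<in> Fs" for F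
  proof
    assume "contains_subgraph (core_join n S {}) F"
    then obtain T f where T: "covering F T" "card T \<le> card S"
      "\<forall>e\<in>edges F. e \<subseteq> T \<longrightarrow> f ` e \<in> ({} :: nat set set)"
      by (rule contains_core_joinE[OF simple[OF F] _ fS empty_subsetI]) (rule that)
    then have "independent_set F T" by (auto simp: independent_set_def covering_def)
    then show False using indep_cover_ge[OF F T(1)] T(2) assms by simp
  qed
  then show ?thesis
    using assms fin_simple_graph_core_join[of S n "{}"] by (auto simp: free_graphs_def core_join_def)
qed

lemma spectral_extremal_ge:
  assumes G: "G \<in> spectral_extremal n Fs" and n: "k < n"
  shows "sqrt (real k * (real n - real k)) \<le> spectral_radius (adjacency_matrix n G)"
proof -
  define B where "B = core_join n {..<k} {}"
  \<comment> \<open>This is an eigenvector of the complete bipartite graph for its largest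
    eigenvalue; both sides carry the same squared weight p.\<close>
  define y where "y i = (if i < k then sqrt (real n - real k) else sqrt (real k))" for i
  define p where "p = real k * (real n - real k)"
  have p: "p > 0" using n k by (simp add: p_def)
  have sub: "{..<k} \<subseteq> {..<n}" using n by auto
  have B: "B \<in> free_graphs n Fs" unfolding B_def using sub by (intro bipartite_free) auto
  have cH: "real (card ({..<n} - {..<k})) = real n - real k"
    using n by (subst card_Diff_subset) auto
  have s1: "(\<Sum>i<k. y i) = real k * sqrt (real n - real k)" by (simp add: y_def)
  have s2: "(\<Sum>i\<in>{..<n} - {..<k}. y i) = (real n - real k) * sqrt (real k)"
    using cH by (simp add: y_def)
  have "(\<Sum>i<n. (y i)\<^sup>2) = (\<Sum>i<k. (y i)\<^sup>2) + (\<Sum>i\<in>{..<n} - {..<k}. (y i)\<^sup>2)"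
    using sum.subset_diff[OF sub, of "\<lambda>i. (y i)\<^sup>2"] by simp
  also have "(\<Sum>i<k. (y i)\<^sup>2) = p" using n by (simp add: y_def p_def)
  also have "(\<Sum>i\<in>{..<n} - {..<k}. (y i)\<^sup>2) = p" using cH by (simp add: y_def p_def)
  finally have norm: "(\<Sum>i<n. (y i)\<^sup>2) = 2 * p" by simp
  have "2 * p * sqrt p = 2 * block_form (adj B) {..<k} ({..<n} - {..<k}) y"
    unfolding B_def block_form_fully_joined[OF fully_joined_core_join verts_core_join] s1 s2
    by (simp add: p_def real_sqrt_mult)
  also have "\<dots> \<le> quad_form n (adj B) y"
  proof -
    have "block_form (adj B) X X y \<ge> 0" for X
      unfolding block_form_def by (intro sum_nonneg mult_nonneg_nonneg adj_nonneg) (use n in \<open>auto simp: y_def\<close>)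
    then show ?thesis unfolding quad_form_eq_block_form block_form_split[OF sub adj_sym] by simp
  qed
  also have "\<dots> \<le> spectral_radius (adjacency_matrix n B) * (2 * p)"
    using rayleigh_le_spectral_radius[of n B y] n norm by simp
  also have "\<dots> \<le> spectral_radius (adjacency_matrix n G) * (2 * p)"
    using G B p by (intro mult_right_mono) (auto simp: spectral_extremal_def)
  finally have "sqrt p \<le> spectral_radius (adjacency_matrix n G)" using p by simp
  then show ?thesis by (simp add: p_def)
qed

lemma rejoin_free:
  assumes G: "G \<in> free_graphs n Fs" and S: "S \<subseteq> {..<n}" "R \<subseteq> {..<n} - S"
    and big: "(\<Sum>F\<in>Fs. 2 * card (verts F)) \<le> card (common_nbrs G S)"
  shows "rejoin G S R \<in> free_graphs n Fs"
proof -
  have V: "fin_simple_graph G" "verts G = {..<n}" using G by (auto simp: free_graphs_def)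
  have "\<not> contains_subgraph (rejoin G S R) F" if F: "F \<in> Fs" for F
  proof
    assume c: "contains_subgraph (rejoin G S R) F"
    have "2 * card (verts F) \<le> (\<Sum>F\<in>Fs. 2 * card (verts F))"
      using F finite_Fs by (intro member_le_sum[of F Fs "\<lambda>F. 2 * card (verts F)"]) auto
    then have "contains_subgraph G F"
      using big S V by (intro contains_rejoin_imp[OF simple[OF F] V(1) _ _ _ c]) auto
    then show False using G F by (auto simp: free_graphs_def)
  qed
  then show ?thesis
    using fin_simple_graph_rejoin[of G S R] V S by (auto simp: free_graphs_def rejoin_def)
qed

text \<open>The interface between the spectral and the counting arguments: a lexicographic maximum,
  of core pairs and then of outer pairs for an unchanged core, among free graphs joined along the
  same S.\<close>

definition dominant_core :: "nat \<Rightarrow> nat ugraph \<Rightarrow> nat set \<Rightarrow> bool" where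
  "dominant_core n G S \<longleftrightarrow> S \<subseteq> {..<n} \<and> card S = k \<and> fully_joined G S \<and>
     (\<forall>G'\<in>free_graphs n Fs. fully_joined G' S \<longrightarrow> card (adj_pairs G' S) \<le> card (adj_pairs G S)) \<and>
     (\<forall>G'\<in>free_graphs n Fs. fully_joined G' S \<longrightarrow>
        (\<forall>i\<in>S. \<forall>j\<in>S. {i, j} \<in> edges G' \<longleftrightarrow> {i, j} \<in> edges G) \<longrightarrow>
        card (adj_pairs G' ({..<n} - S)) \<le> card (adj_pairs G ({..<n} - S)))"

lemma spectral_extremal_dominant_core:
  "\<forall>\<^sub>F n in sequentially. \<forall>G\<in>spectral_extremal n Fs. \<exists>S. dominant_core n G S"
proof -
  obtain F T where F: "F \<in> Fs" "covering F T" "independent_set F T" "card T = Suc k"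
    by (rule indep_cover_witness)
  define M where "M = card (verts F)"
  \<comment> \<open>Enough common neighbours of the hubs for rejoining to be harmless for every
    member of the family at once.\<close>
  define P where "P = (\<Sum>F\<in>Fs. 2 * card (verts F))"
  obtain t0 where t0: "\<And>t. t \<ge> t0 \<Longrightarrow> large k (2 * s) M P t"
    using eventually_large[of k "2 * s" M P] unfolding eventually_at_top_linorder by auto
  \<comment> \<open>This gives k < n and t0^2 \<le> n - k \<le> k(n - k), so that \<rho> reaches
    t0.\<close>
  define n0 where "n0 = k + 1 + nat \<lceil>t0\<^sup>2\<rceil>"
  show ?thesis
  proof (rule eventually_sequentiallyI[of n0], rule ballI)
    fix n G assume n: "n \<ge> n0" and G: "G \<in> spectral_extremal n Fs"
    define \<rho> where "\<rho> = spectral_radius (adjacency_matrix n G)"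
    have kn: "k < n" using n by (simp add: n0_def)
    then have n_pos: "n > 0" by simp
    have free: "G \<in> free_graphs n Fs" using G by (simp add: spectral_extremal_def)
    then have V: "fin_simple_graph G" "verts G = {..<n}" by (auto simp: free_graphs_def)
    have max: "quad_form n (adj G') y \<le> \<rho> * (\<Sum>i<n. (y i)\<^sup>2)" if "G' \<in> free_graphs n Fs" for G' y
    proof -
      have "quad_form n (adj G') y \<le> spectral_radius (adjacency_matrix n G') * (\<Sum>i<n. (y i)\<^sup>2)"
        by (rule rayleigh_le_spectral_radius[OF n_pos])
      also have "\<dots> \<le> \<rho> * (\<Sum>i<n. (y i)\<^sup>2)"
        using G that by (intro mult_right_mono sum_nonneg) (auto simp: spectral_extremal_def \<rho>_def)
      finally show ?thesis .
    qed
    have \<rho>_ge: "sqrt (real k * (real n - real k)) \<le> \<rho>"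
      unfolding \<rho>_def by (rule spectral_extremal_ge[OF G kn])
    have "t0\<^sup>2 \<le> real n - real k" using n unfolding n0_def by linarith
    also have "\<dots> \<le> real k * (real n - real k)" using k kn by simp
    finally have "\<bar>t0\<bar> \<le> sqrt (real k * (real n - real k))" using real_le_rsqrt by force
    then have "t0 \<le> \<rho>" using \<rho>_ge by linarith
    then have lg: "large k (2 * s) M P \<rho>" by (rule t0)
    have "0 \<le> real k * (real n - real k)" using kn by simp
    then have "real k * (real n - real k) = (sqrt (real k * (real n - real k)))\<^sup>2" by simp
    also have "\<dots> \<le> \<rho>\<^sup>2" using \<rho>_ge \<open>0 \<le> real k * (real n - real k)\<close> by (intro power_mono) auto
    finally have \<rho>2: "real k * (real n - real k) \<le> \<rho>\<^sup>2" .
    obtain y where y: "\<And>i. y i \<ge> 0" "(\<Sum>i<n. (y i)\<^sup>2) = 1"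
      "\<And>i. i < n \<Longrightarrow> (\<Sum>j<n. adj G i j * y j) = \<rho> * y i"
      using perron_vector_exists[OF n_pos, of G] unfolding \<rho>_def by auto
    define m where "m = Max (y ` {..<n})"
    have ym: "y i \<le> m" if "i < n" for i unfolding m_def using that by (intro Max_ge) auto
    have "m \<in> y ` {..<n}" unfolding m_def using n_pos by (intro Max_in) auto
    then obtain u where u: "u < n" "y u = m" by auto
    have m0: "m > 0"
    proof (rule ccontr)
      assume "\<not> m > 0"
      then have "y i = 0" if "i < n" for i using ym[OF that] y(1)[of i] by linarith
      then show False using y(2) by simp
    qed
    define x where "x i = y i / m" for i
    obtain C where C: "C \<subseteq> verts G" "card C \<le> 2 * s" "\<And>e. e \<in> edges G \<Longrightarrow> e \<inter> C \<noteq> {}"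
      using small_cover_of_matching_free[OF V(1), of s] free matching by (auto simp: free_graphs_def)
    interpret near_extremal G n k "2 * s" M P C \<rho> x
    proof
      show "fin_simple_graph G" "verts G = {..<n}" "1 \<le> k" using V k by auto
      show "C \<subseteq> {..<n}" "card C \<le> 2 * s" "\<And>e. e \<in> edges G \<Longrightarrow> e \<inter> C \<noteq> {}" using C V by auto
      show "card (common_nbrs G L) < M" if L: "L \<subseteq> {..<n}" "card L = Suc k" for L
      proof (rule ccontr)
        assume "\<not> card (common_nbrs G L) < M"
        then have "contains_subgraph G F"
          using L F V by (intro contains_of_common_nbrs[OF simple[OF F(1)] F(2,3) V(1)]) (auto simp: M_def)
        then show False using free F(1) by (auto simp: free_graphs_def)
      qed
      show "(\<Sum>j<n. adj G i j * x j) = \<rho> * x i" if "i < n" for i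
        using y(3)[OF that] by (simp add: x_def sum_divide_distrib[symmetric])
      show "0 \<le> x i" for i using y(1) m0 by (simp add: x_def)
      show "x i \<le> 1" if "i < n" for i using ym[OF that] m0 by (simp add: x_def)
      show "\<exists>u<n. x u = 1" using u m0 by (auto simp: x_def)
    qed (use \<rho>2 lg in auto)
    have "rejoin G S R \<in> free_graphs n Fs"
      using card_common_nbrs_S R_subset S_subset by (intro rejoin_free[OF free]) (auto simp: P_def)
    then have full: "R = {}" using max by (intro S_full)
    show "\<exists>S. dominant_core n G S"
      unfolding dominant_core_def
    proof (intro exI[of _ S] conjI ballI impI S_subset card_S fully_joined_S[OF full])
      fix G' assume G': "G' \<in> free_graphs n Fs" "fully_joined G' S"
      then have V': "verts G' = {..<n}" by (auto simp: free_graphs_def)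
      show "card (adj_pairs G' S) \<le> card (adj_pairs G S)"
        by (rule core_pairs_max[OF full V' G'(2) max[OF G'(1)]])
      assume "\<forall>i\<in>S. \<forall>j\<in>S. {i, j} \<in> edges G' \<longleftrightarrow> {i, j} \<in> edges G"
      then show "card (adj_pairs G' ({..<n} - S)) \<le> card (adj_pairs G ({..<n} - S))"
        by (intro outer_pairs_max[OF full V' G'(2) _ max[OF G'(1)]]) auto
    qed
  qed
qed

section \<open>The case k = s: a bound for all free graphs\<close>

lemma core_pairs_max_any_position:
  assumes S: "S \<subseteq> {..<n}" "card S = k"
    and max: "\<And>G'. G' \<in> free_graphs n Fs \<Longrightarrow> fully_joined G' S \<Longrightarrow> card (adj_pairs G' S) \<le> t"
    and G': "G' \<in> free_graphs n Fs" and S': "S' \<subseteq> {..<n}" "card S' = k" "fully_joined G' S'"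
  shows "card (adj_pairs G' S') \<le> t"
proof -
  have fin: "finite S" "finite S'" using S S' finite_subset by blast+
  \<comment> \<open>A permutation of the labels moves S' onto S, where the hypothesis
    applies.\<close>
  obtain g where "bij_betw g S' S" using finite_same_card_bij[OF fin(2,1)] S S' by auto
  then obtain \<psi> where \<psi>: "bij_betw \<psi> {..<n} {..<n}" "\<psi> ` S' = S"
    using extend_bij[OF S(1) S'(1), of g] by (metis bij_betw_imp_surj_on finite_lessThan image_cong)
  have V: "fin_simple_graph G'" "verts G' = {..<n}" using G' by (auto simp: free_graphs_def)
  have inj: "inj_on \<psi> (verts G')" using \<psi>(1) V by (simp add: bij_betw_def)
  have "card (adj_pairs (relabel \<psi> G') (\<psi> ` S')) = card (adj_pairs G' S')"
    using S'(1) V by (intro card_adj_pairs_relabel[OF V(1) inj]) simp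
  moreover have "fully_joined (relabel \<psi> G') (\<psi> ` S')"
    using fully_joined_relabel[OF V(1) inj] S' V by simp
  ultimately show ?thesis using max[OF relabel_free[OF G' \<psi>(1)]] \<psi>(2) by simp
qed

text \<open>A graph with at least \<open>s (n - s)\<close> edges and no matching of size \<open>s + 1\<close> is covered by \<open>s\<close>
  vertices of large degree. Either nearly all vertices see all of them, and completing the join
  keeps the graph free, or linearly many edges are missing.\<close>

lemma edges_le_of_core_bound:
  assumes ks: "k = s"
    and n: "n > 10 * k * (k + 1) + (\<Sum>F\<in>Fs. 2 * card (verts F))"
    and S: "S \<subseteq> {..<n}" "card S = k"
    and max: "\<And>G'. G' \<in> free_graphs n Fs \<Longrightarrow> fully_joined G' S \<Longrightarrow> card (adj_pairs G' S) \<le> t"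
    and G: "G \<in> free_graphs n Fs"
  shows "2 * card (edges G) \<le> t + 2 * (k * (n - k))"
proof (rule ccontr)
  assume "\<not> ?thesis"
  then have gt: "2 * card (edges G) > t + 2 * (k * (n - k))" by simp
  define P where "P = (\<Sum>F\<in>Fs. 2 * card (verts F))"
  have V: "fin_simple_graph G" "verts G = {..<n}" using G by (auto simp: free_graphs_def)
  have kn: "k \<le> n" using n by (simp add: algebra_simps)
  define d where "d w = card {u \<in> verts G. {w, u} \<in> edges G}" for w
  have dn: "d w \<le> n" for w
    using card_mono[of "{..<n}" "{u \<in> verts G. {w, u} \<in> edges G}"] V by (auto simp: d_def)
  have nomatch: "\<not> contains_subgraph G (matching_graph (Suc s))"
    using G matching by (auto simp: free_graphs_def)
  obtain C where C: "C \<subseteq> verts G" "card C \<le> 2 * s" "\<And>e. e \<in> edges G \<Longrightarrow> e \<inter> C \<noteq> {}"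
    using small_cover_of_matching_free[OF V(1) nomatch] by auto
  have fC: "finite C" using C(1) V finite_subset by auto
  define Hd where "Hd = {w \<in> C. d w \<ge> 2 * k + 2}"
  \<comment> \<open>With at most k - 1 vertices of large degree in the cover there are at most (k -
    1) n + O(k^2) edges, too few. The term 10 k (k + 1) in the hypothesis on n leaves room for this
    O(k^2).\<close>
  have "k \<le> card Hd"
  proof (rule ccontr)
    assume "\<not> k \<le> card Hd"
    then have cH: "card Hd \<le> k - 1" by simp
    have "card (edges G) \<le> (\<Sum>w\<in>C. d w)"
      unfolding d_def by (rule card_edges_le_sum_degrees[OF V(1) fC C(3)])
    also have "\<dots> \<le> (\<Sum>w\<in>C. (if w \<in> Hd then n else 0) + (2 * k + 2))"
    proof (intro sum_mono)
      fix w assume "w \<in> C"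
      then show "d w \<le> (if w \<in> Hd then n else 0) + (2 * k + 2)" using dn[of w] by (simp add: Hd_def)
    qed
    also have "\<dots> = (\<Sum>w\<in>C. if w \<in> Hd then n else 0) + card C * (2 * k + 2)"
      by (simp only: sum.distrib sum_constant of_nat_id distrib_left)
    also have "(\<Sum>w\<in>C. if w \<in> Hd then n else 0) = card Hd * n"
    proof -
      have "C \<inter> Hd = Hd" by (auto simp: Hd_def)
      then show ?thesis using fC by (simp add: sum.inter_restrict[symmetric])
    qed
    also have "card Hd * n + card C * (2 * k + 2) \<le> (k - 1) * n + (2 * k) * (2 * k + 2)"
      using cH C(2) ks by (intro add_mono mult_right_mono) auto
    finally have "card (edges G) \<le> (k - 1) * n + (2 * k) * (2 * k + 2)" .
    moreover have "(k - 1) * n + (2 * k) * (2 * k + 2) \<le> k * (n - k)"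
    proof -
      obtain j where j: "k = Suc j" using k by (cases k) auto
      obtain i where i: "n = k + i" using kn le_Suc_ex by blast
      have "4 * k * (k + 1) + j * k \<le> i"
        using n i j by (simp add: algebra_simps)
      then show ?thesis unfolding i using j by (simp add: algebra_simps)
    qed
    ultimately show False using gt by linarith
  qed
  then obtain S' where S': "S' \<subseteq> Hd" "card S' = k" by (meson obtain_subset_with_card_n)
  have S'n: "S' \<subseteq> {..<n}" using S' C V by (auto simp: Hd_def)
  have fS': "finite S'" using S'n finite_subset by blast
  \<comment> \<open>Since k = s, an edge avoiding S' would extend to a matching of size s + 1. So
    all edges meet S'.\<close>
  have cov: "e \<inter> S' \<noteq> {}" if "e \<in> edges G" for e
  proof
    assume "e \<inter> S' = {}"
    then have "contains_subgraph G (matching_graph (Suc (card S')))"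
      using S' S'n V that by (intro contains_matching_of_large_degrees[OF V(1) fS']) (auto simp: Hd_def d_def)
    then show False using nomatch S' ks by simp
  qed
  have "adj_pairs G ({..<n} - S') = {}" using cov by (auto simp: adj_pairs_def)
  then have split: "2 * real (card (edges G)) = real (card (adj_pairs G S'))
      + 2 * (\<Sum>i\<in>S'. \<Sum>j\<in>{..<n} - S'. adj G i j)"
    using card_edges_split[OF V S'n] by simp
  have cV: "card ({..<n} - S') = n - k" using S'n S' fS' by (simp add: card_Diff_subset)
  let ?K = "common_nbrs G S'"
  have K: "?K \<subseteq> {..<n} - S'" using common_nbrs_disjoint[OF V(1), of S'] V by (auto simp: common_nbrs_def)
  show False
  proof (cases "P \<le> card ?K")
    case True
    \<comment> \<open>These are the vertices not yet joined to all of S'. Rejoining them keeps the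
      edges inside S' and completes the join, so the core bound t becomes available for S'.\<close>
    define R where "R = {..<n} - S' - ?K"
    let ?G = "rejoin G S' R"
    have G': "?G \<in> free_graphs n Fs"
      using True by (intro rejoin_free[OF G S'n]) (auto simp: R_def P_def)
    have fj: "fully_joined ?G S'"
      unfolding fully_joined_def
    proof (intro ballI)
      fix w v assume wv: "w \<in> S'" "v \<in> verts ?G - S'"
      show "{w, v} \<in> edges ?G"
      proof (cases "v \<in> R")
        case True
        then show ?thesis using wv by (auto simp: rejoin_def)
      next
        case False
        then have "v \<in> ?K" using wv V by (auto simp: R_def rejoin_def)
        then have "{w, v} \<in> edges G" using wv by (auto simp: common_nbrs_def)
        moreover have "{w, v} \<inter> R = {}" using False wv by (auto simp: R_def)
        ultimately show ?thesis by (simp add: rejoin_def)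
      qed
    qed
    have "adj_pairs G S' \<subseteq> adj_pairs ?G S'" by (auto simp: adj_pairs_def rejoin_def R_def)
    then have "card (adj_pairs G S') \<le> card (adj_pairs ?G S')"
      using fS' by (intro card_mono finite_adj_pairs)
    also have "\<dots> \<le> t" by (rule core_pairs_max_any_position[OF S max G' S'n S'(2) fj])
    finally have "real (card (adj_pairs G S')) \<le> real t" by simp
    moreover have "(\<Sum>i\<in>S'. \<Sum>j\<in>{..<n} - S'. adj G i j) \<le> (\<Sum>i\<in>S'. \<Sum>j\<in>{..<n} - S'. 1)"
      using adj_le_1 by (intro sum_mono)
    then have "(\<Sum>i\<in>S'. \<Sum>j\<in>{..<n} - S'. adj G i j) \<le> real (k * (n - k))"
      using cV S' by simp
    ultimately have "2 * real (card (edges G)) \<le> real t + 2 * real (k * (n - k))" using split by linarith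
    then have "real (2 * card (edges G)) \<le> real (t + 2 * (k * (n - k)))" by simp
    then show False using gt unfolding of_nat_le_iff by linarith
  next
    case False
    \<comment> \<open>Counted from outside S', every vertex not in \<open>?K\<close> misses at least
      one edge. The more than n - k - P missing edges outweigh the at most k^2 core pairs.\<close>
    have "(\<Sum>i\<in>S'. \<Sum>j\<in>{..<n} - S'. adj G i j) = (\<Sum>j\<in>{..<n} - S'. \<Sum>i\<in>S'. adj G i j)"
      by (rule sum.swap)
    also have "\<dots> \<le> (\<Sum>j\<in>{..<n} - S'. (real k - 1) + (if j \<in> ?K then 1 else 0))"
    proof (intro sum_mono)
      fix j assume j: "j \<in> {..<n} - S'"
      show "(\<Sum>i\<in>S'. adj G i j) \<le> (real k - 1) + (if j \<in> ?K then 1 else 0)"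
      proof (cases "j \<in> ?K")
        case True
        have "(\<Sum>i\<in>S'. adj G i j) \<le> (\<Sum>i\<in>S'. 1)" using adj_le_1 by (intro sum_mono)
        then show ?thesis using True S' by simp
      next
        case False
        then obtain w where w: "w \<in> S'" "{w, j} \<notin> edges G" using j V by (auto simp: common_nbrs_def)
        have "(\<Sum>i\<in>S'. adj G i j) = adj G w j + (\<Sum>i\<in>S' - {w}. adj G i j)"
          using w fS' by (simp add: sum.remove)
        also have "\<dots> \<le> 0 + (\<Sum>i\<in>S' - {w}. 1)"
          using adj_le_1 w by (intro add_mono sum_mono) (auto simp: adj_def)
        also have "\<dots> = real k - 1" using w S' fS' k by simp
        finally show ?thesis using False by simp
      qed
    qed
    also have "\<dots> = real (n - k) * (real k - 1) + real (card ?K)"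
    proof -
      have "({..<n} - S') \<inter> ?K = ?K" using K by auto
      then have "(\<Sum>j\<in>{..<n} - S'. if j \<in> ?K then 1 else 0) = real (card ?K)"
        by (simp add: sum.inter_restrict[symmetric])
      then show ?thesis by (simp add: sum.distrib cV)
    qed
    finally have cr: "(\<Sum>i\<in>S'. \<Sum>j\<in>{..<n} - S'. adj G i j) \<le> real (n - k) * (real k - 1) + real (card ?K)" .
    have "card (adj_pairs G S') \<le> card (S' \<times> S')"
      using fS' by (intro card_mono) (auto simp: adj_pairs_def)
    then have "card (adj_pairs G S') \<le> k * k" using S' by (simp add: card_cartesian_product)
    then have p: "real (card (adj_pairs G S')) \<le> real (k * k)" by (rule of_nat_mono)
    have K': "real (card ?K) \<le> real P" using False by simp
    have "2 * real (card (edges G)) \<le> real (k * k) + 2 * (real (n - k) * (real k - 1) + real P)"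
      unfolding split by (intro add_mono p mult_left_mono order_trans[OF cr] K') auto
    also have "\<dots> = 2 * real (k * (n - k)) + (real (k * k) + 2 * real P - 2 * real (n - k))"
      unfolding of_nat_mult[of k "n - k"] by (simp only: ring_distribs mult_1_right mult.commute[of "real k"])
    also have "\<dots> \<le> 2 * real (k * (n - k))"
    proof -
      have "k * k + 2 * P \<le> 2 * (n - k)" using n unfolding P_def[symmetric] by (simp add: algebra_simps)
      then have "real (k * k + 2 * P) \<le> real (2 * (n - k))" by (rule of_nat_mono)
      then show ?thesis by simp
    qed
    finally have "real (2 * card (edges G)) \<le> real (2 * (k * (n - k)))" by simp
    then have "2 * card (edges G) \<le> 2 * (k * (n - k))" by (simp only: of_nat_le_iff)
    then show False using gt by linarith
  qed
qed

text \<open>A spectrally extremal graph has all edges between core and rest, so its own core pairs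
  already make it reach the upper bound for free graphs.\<close>

lemma spectral_extremal_subset_edge_extremal:
  assumes ks: "k = s"
  shows "\<forall>\<^sub>F n in sequentially. spectral_extremal n Fs \<subseteq> edge_extremal n Fs"
  using spectral_extremal_dominant_core
    eventually_gt_at_top[of "10 * k * (k + 1) + (\<Sum>F\<in>Fs. 2 * card (verts F))"]
proof eventually_elim
  case (elim n)
  show ?case
  proof
    fix G assume G: "G \<in> spectral_extremal n Fs"
    then obtain S where "dominant_core n G S" using elim(1) by blast
    then have S: "S \<subseteq> {..<n}" "card S = k" "fully_joined G S"
      "\<And>G'. G' \<in> free_graphs n Fs \<Longrightarrow> fully_joined G' S \<Longrightarrow> card (adj_pairs G' S) \<le> card (adj_pairs G S)"
      by (simp_all add: dominant_core_def)
    have free: "G \<in> free_graphs n Fs" using G by (simp add: spectral_extremal_def)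
    then have V: "fin_simple_graph G" "verts G = {..<n}" by (auto simp: free_graphs_def)
    have "2 * real (card (edges G)) \<ge> real (card (adj_pairs G S)) + 2 * (real k * real (n - k))"
      using card_edges_fully_joined[OF V S(1,3)] S(2) by simp
    then have "real (card (adj_pairs G S) + 2 * (k * (n - k))) \<le> real (2 * card (edges G))" by simp
    then have ge: "card (adj_pairs G S) + 2 * (k * (n - k)) \<le> 2 * card (edges G)"
      by (simp only: of_nat_le_iff)
    have "card (edges G') \<le> card (edges G)" if G': "G' \<in> free_graphs n Fs" for G'
      using edges_le_of_core_bound[OF ks elim(2) S(1,2,4) G'] ge by simp
    then show "G \<in> edge_extremal n Fs" using free by (simp add: edge_extremal_def)
  qed
qed

section \<open>The core as an extremal graph, and extremality among graphs containing the
  join\<close>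

lemma core_family_free: "free_graphs k (core_family Fs) = free_graphs k (covering_family Fs)"
proof (cases "fam_indep_cover_num Fs = fam_cover_num Fs")
  case True
  have "fam_cover_num Fs \<le> enat (card S)" if "F \<in> Fs" "covering F S" for F S
  proof -
    have "fam_cover_num Fs \<le> cover_num F" unfolding fam_cover_num_def using that by (intro INF_lower)
    also have "\<dots> \<le> enat (card S)" unfolding cover_num_def using that by (intro INF_lower) simp
    finally show ?thesis .
  qed
  \<comment> \<open>No covering is smaller than the independent covering number here. On the other
    side, a complete graph on k + 1 vertices does not fit into k vertices, so both families impose
    no restriction.\<close>
  then have "covering_family Fs = {}" using True unfolding covering_family_def by force
  moreover have "\<not> contains_subgraph G (complete_graph (Suc k))" if V: "verts G = {..<k}" for G :: "nat ugraph"
  proof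
    assume "contains_subgraph G (complete_graph (Suc k))"
    then obtain f where "inj_on f {..<Suc k}" "f ` {..<Suc k} \<subseteq> {..<k}"
      by (auto simp: contains_subgraph_def complete_graph_def V)
    then have "card {..<Suc k} \<le> card {..<k}" by (rule card_inj_on_le) simp
    then show False by simp
  qed
  moreover have "core_family Fs = {complete_graph (the_enat (fam_indep_cover_num Fs))}"
    unfolding core_family_def by (rule if_P[OF True])
  then have "core_family Fs = {complete_graph (Suc k)}" by (simp add: indep_cover)
  ultimately show ?thesis by (auto simp: free_graphs_def)
next
  case False
  then show ?thesis by (simp add: core_family_def)
qed

text \<open>The counterpart of \<open>contains_core_joinE\<close>. Vertices outside the covering T
  may go anywhere outside S: an edge not inside T has exactly one end in T and is mapped to a join
  edge.\<close>

lemma contains_of_fully_joined: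
  fixes n :: nat
  assumes F: "F \<in> Fs" "covering F T"
    and G: "fin_simple_graph G" "verts G = {..<n}" "S \<subseteq> {..<n}" "fully_joined G S"
    and big: "card (verts F) \<le> card ({..<n} - S)"
    and f: "inj_on f T" "f ` T \<subseteq> S" "\<And>e. e \<in> edges F \<Longrightarrow> e \<subseteq> T \<Longrightarrow> f ` e \<in> edges G"
  shows "contains_subgraph G F"
proof -
  have fF: "finite (verts F)" using simple[OF F(1)] by (simp add: fin_simple_graph_def)
  have TF: "T \<subseteq> verts F" using F(2) by (simp add: covering_def)
  have "card (verts F - T) \<le> card ({..<n} - S)"
    using big card_mono[of "verts F" "verts F - T"] fF by auto
  then obtain h where h: "inj_on h (verts F - T)" "h ` (verts F - T) \<subseteq> {..<n} - S"
    using card_le_inj[OF finite_Diff[OF fF] finite_Diff[OF finite_lessThan]] by blast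
  define f' where "f' v = (if v \<in> T then f v else h v)" for v
  have fS: "f v \<in> S" if "v \<in> T" for v using f that by auto
  have hH: "h v \<in> {..<n} - S" if "v \<in> verts F - T" for v using h that by auto
  have "inj_on f' (T \<union> (verts F - T))"
    unfolding inj_on_Un
  proof (intro conjI)
    show "inj_on f' T" using f(1) by (rule inj_on_cong[THEN iffD1, rotated]) (simp add: f'_def)
    show "inj_on f' (verts F - T)" using h(1) by (rule inj_on_cong[THEN iffD1, rotated]) (simp add: f'_def)
    show "f' ` (T - (verts F - T)) \<inter> f' ` (verts F - T - T) = {}"
      using fS hH by (fastforce simp: f'_def)
  qed
  moreover have "T \<union> (verts F - T) = verts F" using TF by auto
  ultimately have "inj_on f' (verts F)" by simp
  moreover have "f' ` verts F \<subseteq> verts G"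
    using fS hH G(2,3) by (fastforce simp: f'_def)
  moreover have "f' ` e \<in> edges G" if e: "e \<in> edges F" for e
  proof (cases "e \<subseteq> T")
    case True
    then have "f' ` e = f ` e" by (intro image_cong) (auto simp: f'_def)
    then show ?thesis using f(3)[OF e True] by simp
  next
    case False
    obtain a b where ab: "e = {a, b}" "a \<in> verts F" "b \<in> verts F"
      using simple_graph_edgeE[OF simple[OF F(1)] e] by metis
    have edge: "{f u, h v} \<in> edges G" if "u \<in> T" "v \<in> verts F - T" for u v
      using fS[OF that(1)] hH[OF that(2)] G(2,4) by (auto simp: fully_joined_def)
    have "a \<in> T \<or> b \<in> T" using F(2) e ab by (auto simp: covering_def)
    then show ?thesis using False edge[of a b] edge[of b a] ab by (auto simp: f'_def insert_commute)
  qed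
  ultimately show ?thesis unfolding contains_subgraph_def by blast
qed

text \<open>A copy of F would meet S in the image of a covering U with at most k vertices. Pulled
  back along g, it shows the induced subgraph on U inside T, and that subgraph belongs to the
  covering family because k is below the independent covering number.\<close>

lemma core_join_free:
  assumes S: "S \<subseteq> {..<n}" and g: "bij_betw g {..<k} S"
    and T: "T \<in> free_graphs k (covering_family Fs)"
  shows "core_join n S ((\<lambda>e. g ` e) ` edges T) \<in> free_graphs n Fs"
proof -
  let ?A = "(\<lambda>e. g ` e) ` edges T"
  have fS: "finite S" using S finite_subset by blast
  have cS: "card S = k" using bij_betw_same_card[OF g] by simp
  have inj: "inj_on g {..<k}" and gS: "g ` {..<k} = S" using g by (auto simp: bij_betw_def)
  have VT: "fin_simple_graph T" "verts T = {..<k}" using T by (auto simp: free_graphs_def)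
  have A: "e \<subseteq> S \<and> card e = 2" if e: "e \<in> ?A" for e
  proof -
    obtain e' where e': "e' \<in> edges T" "e = g ` e'" using e by auto
    then have "e' \<subseteq> {..<k}" "card e' = 2" using VT by (auto simp: fin_simple_graph_def)
    then show ?thesis using e' gS card_image[OF inj_on_subset[OF inj]] by auto
  qed
  then have AS: "?A \<subseteq> Pow S" by blast
  have "\<not> contains_subgraph (core_join n S ?A) F" if F: "F \<in> Fs" for F
  proof
    assume sub: "contains_subgraph (core_join n S ?A) F"
    obtain U f where U: "covering F U" "card U \<le> card S" "inj_on f U" "f ` U \<subseteq> S"
      "\<forall>e\<in>edges F. e \<subseteq> U \<longrightarrow> f ` e \<in> ?A"
      by (rule contains_core_joinE[OF simple[OF F] sub fS AS]) (rule that)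
    let ?h = "inv_into {..<k} g \<circ> f"
    have "contains_subgraph T (induced_subgraph F U)"
      unfolding contains_subgraph_def induced_subgraph_def ugraph.simps VT(2)
    proof (intro exI[of _ ?h] conjI ballI)
      show "inj_on ?h U" using U(3,4) gS by (intro comp_inj_on inj_on_inv_into) auto
      show "?h ` U \<subseteq> {..<k}"
      proof
        fix y assume "y \<in> ?h ` U"
        then obtain u where u: "u \<in> U" "y = inv_into {..<k} g (f u)" by auto
        have "f u \<in> g ` {..<k}" using u U(4) gS by auto
        then show "y \<in> {..<k}" unfolding u(2) by (rule inv_into_into)
      qed
      fix e assume "e \<in> {e \<in> edges F. e \<subseteq> U}"
      then have "f ` e \<in> ?A" using U(5) by simp
      then obtain e' where e': "e' \<in> edges T" "f ` e = g ` e'" by auto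
      have "e' \<subseteq> {..<k}" using e' VT by (auto simp: fin_simple_graph_def)
      then have "?h ` e = e'" using inv_into_image_cancel[OF inj]
        unfolding image_comp[symmetric] e'(2) by simp
      then show "?h ` e \<in> edges T" using e' by simp
    qed
    moreover have "induced_subgraph F U \<in> covering_family Fs"
      using F U(1,2) cS unfolding covering_family_def indep_cover
      by (intro CollectI exI[of _ F] exI[of _ U]) simp
    ultimately show False using T by (auto simp: free_graphs_def)
  qed
  then show ?thesis
    using fin_simple_graph_core_join[OF S A] by (auto simp: free_graphs_def core_join_def)
qed

lemma spectral_extremal_subset_join_extremal:
  "\<forall>\<^sub>F n in sequentially. spectral_extremal n Fs \<subseteq> join_extremal n Fs"
  using spectral_extremal_dominant_core eventually_gt_at_top[of "k + (\<Sum>F\<in>Fs. card (verts F))"]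
proof eventually_elim
  case (elim n)
  show ?case
  proof
    fix G assume G: "G \<in> spectral_extremal n Fs"
    then obtain S where "dominant_core n G S" using elim(1) by blast
    then have S: "S \<subseteq> {..<n}" "card S = k" "fully_joined G S"
      and core: "\<And>G'. G' \<in> free_graphs n Fs \<Longrightarrow> fully_joined G' S \<Longrightarrow> card (adj_pairs G' S) \<le> card (adj_pairs G S)"
      and outer: "\<And>G'. G' \<in> free_graphs n Fs \<Longrightarrow> fully_joined G' S \<Longrightarrow>
        (\<forall>i\<in>S. \<forall>j\<in>S. {i, j} \<in> edges G' \<longleftrightarrow> {i, j} \<in> edges G) \<Longrightarrow>
        card (adj_pairs G' ({..<n} - S)) \<le> card (adj_pairs G ({..<n} - S))"
      by (simp_all add: dominant_core_def)
    have free: "G \<in> free_graphs n Fs" using G by (simp add: spectral_extremal_def)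
    then have V: "fin_simple_graph G" "verts G = {..<n}" by (auto simp: free_graphs_def)
    have fS: "finite S" using S finite_subset by blast
    have cH: "card ({..<n} - S) = n - k" using S fS by (simp add: card_Diff_subset)
    obtain g where g: "bij_betw g {..<k} S" using finite_same_card_bij[of "{..<k}" S] fS S(2) by auto
    obtain h where h: "bij_betw h {..<n - k} ({..<n} - S)"
      using finite_same_card_bij[of "{..<n - k}" "{..<n} - S"] cH by auto
    have inj: "inj_on g {..<k}" and gS: "g ` {..<k} = S" using g by (auto simp: bij_betw_def)
    \<comment> \<open>The core of G, carried back to the labels \<open>{..<k}\<close> so that it can
      be compared within \<open>edge_extremal k (core_family Fs)\<close>.\<close>
    define T where "T = \<lparr>verts = {..<k}, edges = {e. e \<subseteq> {..<k} \<and> g ` e \<in> edges G}\<rparr>"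
    have card_g: "card (g ` e) = card e" if "e \<subseteq> {..<k}" for e
      using that inj by (intro card_image) (rule inj_on_subset)
    have VT: "fin_simple_graph T" "verts T = {..<k}"
      using V card_g by (auto simp: T_def fin_simple_graph_def)
    have pairs: "card (adj_pairs G S) = 2 * card (edges T)"
    proof -
      have "card (adj_pairs G (g ` {..<k})) = card (adj_pairs T {..<k})"
        by (intro card_adj_pairs_image inj) (auto simp: T_def)
      then show ?thesis using card_adj_pairs[OF VT(1)] VT(2) gS by simp
    qed
    have "\<not> contains_subgraph T X" if X: "X \<in> covering_family Fs" for X
    proof
      obtain F U where F: "X = induced_subgraph F U" "F \<in> Fs" "covering F U"
        using X by (auto simp: covering_family_def)
      assume "contains_subgraph T X"
      then obtain f where f: "inj_on f U" "f ` U \<subseteq> {..<k}"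
        "\<And>e. e \<in> edges F \<Longrightarrow> e \<subseteq> U \<Longrightarrow> f ` e \<in> edges T"
        unfolding F(1) by (auto simp: contains_subgraph_def induced_subgraph_def VT(2))
      have "card (verts F) \<le> (\<Sum>F\<in>Fs. card (verts F))"
        using F(2) finite_Fs by (intro member_le_sum[of F Fs "\<lambda>F. card (verts F)"]) auto
      then have big: "card (verts F) \<le> card ({..<n} - S)" using elim(2) cH by linarith
      have "contains_subgraph G F"
      proof (rule contains_of_fully_joined[OF F(2,3) V S(1,3) big])
        show "inj_on (g \<circ> f) U" using f inj by (intro comp_inj_on) (auto intro: inj_on_subset)
        show "(g \<circ> f) ` U \<subseteq> S" using f(2) gS by auto
        show "(g \<circ> f) ` e \<in> edges G" if "e \<in> edges F" "e \<subseteq> U" for e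
          using f(3)[OF that] by (simp add: T_def image_comp)
      qed
      then show False using free F(2) by (auto simp: free_graphs_def)
    qed
    then have Tfree: "T \<in> free_graphs k (core_family Fs)"
      unfolding core_family_free using VT by (simp add: free_graphs_def)
    have "card (edges T') \<le> card (edges T)" if T': "T' \<in> free_graphs k (core_family Fs)" for T'
    proof -
      \<comment> \<open>A denser core T' would give a free graph joined along the same S with more
        core pairs than G.\<close>
      let ?G = "core_join n S ((\<lambda>e. g ` e) ` edges T')"
      have VT': "fin_simple_graph T'" "verts T' = {..<k}" using T' by (auto simp: free_graphs_def)
      have free': "?G \<in> free_graphs n Fs"
        using T' unfolding core_family_free by (rule core_join_free[OF S(1) g])
      have sub: "e \<subseteq> {..<k}" if "e \<in> edges T'" for e using that VT' by (auto simp: fin_simple_graph_def)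
      have "{g i, g j} \<in> edges ?G \<longleftrightarrow> {i, j} \<in> edges T'" if ij: "i \<in> {..<k}" "j \<in> {..<k}" for i j
      proof
        assume "{g i, g j} \<in> edges ?G"
        moreover have "{g i, g j} \<noteq> {w, v}" if "v \<in> {..<n} - S" for w v
          using that ij gS by (auto simp: doubleton_eq_iff)
        ultimately obtain e where e: "e \<in> edges T'" "g ` {i, j} = g ` e"
          by (auto simp: core_join_def)
        then have "{i, j} = e"
          using inj_on_image_eq_iff[OF inj, of "{i, j}" e] sub[of e] ij by simp
        then show "{i, j} \<in> edges T'" using e by simp
      next
        assume "{i, j} \<in> edges T'"
        then have "g ` {i, j} \<in> (\<lambda>e. g ` e) ` edges T'" by (rule imageI)
        then show "{g i, g j} \<in> edges ?G" by (simp add: core_join_def)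
      qed
      then have "card (adj_pairs ?G (g ` {..<k})) = card (adj_pairs T' {..<k})"
        by (intro card_adj_pairs_image inj)
      then have "card (adj_pairs ?G S) = 2 * card (edges T')"
        using card_adj_pairs[OF VT'(1)] VT'(2) gS by simp
      then show ?thesis using core[OF free' fully_joined_core_join] pairs by simp
    qed
    then have T: "T \<in> edge_extremal k (core_family Fs)" using Tfree by (simp add: edge_extremal_def)
    let ?J = "graph_join T (edgeless_graph (n - k))"
    have VJ: "verts ?J = Inl ` {..<k} \<union> Inr ` {..<n - k}"
      by (simp add: graph_join_def edgeless_graph_def VT(2))
    have EJ: "edges ?J = (\<lambda>e. Inl ` e) ` edges T \<union> {{Inl u, Inr v} | u v. u < k \<and> v < n - k}"
      by (auto simp: graph_join_def edgeless_graph_def VT(2))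
    have cont: "contains_subgraph G ?J"
    proof -
      define f where "f = case_sum g h"
      have hH: "h ` {..<n - k} = {..<n} - S" "inj_on h {..<n - k}" using h by (auto simp: bij_betw_def)
      have gh: "g i \<noteq> h j" if "i < k" "j < n - k" for i j
      proof -
        have "g i \<in> S" "h j \<in> {..<n} - S" using that gS hH(1) by auto
        then show ?thesis by auto
      qed
      have "inj_on f (verts ?J)"
        unfolding VJ inj_on_Un
      proof (intro conjI)
        show "inj_on f (Inl ` {..<k})" using inj by (auto simp: inj_on_def f_def)
        show "inj_on f (Inr ` {..<n - k})" using hH(2) by (auto simp: inj_on_def f_def)
        show "f ` (Inl ` {..<k} - Inr ` {..<n - k}) \<inter> f ` (Inr ` {..<n - k} - Inl ` {..<k}) = {}"
          using gh by (auto simp: f_def)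
      qed
      moreover have "f ` verts ?J \<subseteq> verts G"
        unfolding VJ V(2) image_Un image_image f_def using gS hH(1) S(1) by auto
      moreover have "f ` e \<in> edges G" if "e \<in> edges ?J" for e
        using that unfolding EJ
      proof
        assume "e \<in> (\<lambda>e. Inl ` e) ` edges T"
        then obtain e' where "e' \<in> edges T" "e = Inl ` e'" by auto
        then show ?thesis by (simp add: T_def f_def image_image)
      next
        assume "e \<in> {{Inl u, Inr v} | u v. u < k \<and> v < n - k}"
        then obtain u v where uv: "e = {Inl u, Inr v}" "u < k" "v < n - k" by auto
        have "g u \<in> S" "h v \<in> {..<n} - S" using uv gS hH(1) by auto
        then show ?thesis using S(3) V(2) uv(1) by (simp add: f_def fully_joined_def)
      qed
      ultimately show ?thesis unfolding contains_subgraph_def by blast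
    qed
    have "card (edges G') \<le> card (edges G)"
      if G': "G' \<in> free_graphs n Fs" and sub: "contains_subgraph G' ?J" for G'
    proof -
      have V': "fin_simple_graph G'" "verts G' = {..<n}" using G' by (auto simp: free_graphs_def)
      obtain f where f: "inj_on f (verts ?J)" "f ` verts ?J \<subseteq> {..<n}"
        "\<And>e. e \<in> edges ?J \<Longrightarrow> f ` e \<in> edges G'"
        using sub V'(2) by (auto simp: contains_subgraph_def)
      define S' where "S' = (\<lambda>i. f (Inl i)) ` {..<k}"
      have injl: "inj_on (\<lambda>i. f (Inl i)) {..<k}"
        using f(1) unfolding VJ by (auto simp: inj_on_def)
      have "card (verts ?J) = k + (n - k)"
        unfolding VJ by (subst card_Un_disjoint) (auto simp: card_image)
      then have "card (f ` verts ?J) = n" using card_image[OF f(1)] elim(2) by simp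
      \<comment> \<open>The join has n vertices, so its copy in G' is spanning; hence the image S'
        of the core is joined to all remaining vertices.\<close>
      then have surj: "f ` verts ?J = {..<n}" using f(2) by (intro card_subset_eq) auto
      have S'n: "S' \<subseteq> {..<n}" using f(2) unfolding VJ S'_def by auto
      have fj': "fully_joined G' S'"
        unfolding fully_joined_def
      proof (intro ballI)
        fix w v assume wv: "w \<in> S'" "v \<in> verts G' - S'"
        obtain i where i: "i < k" "w = f (Inl i)" using wv by (auto simp: S'_def)
        have "v \<in> f ` verts ?J" using wv V'(2) surj by simp
        then obtain j where j: "j < n - k" "v = f (Inr j)" using wv unfolding VJ S'_def by auto
        have "f ` {Inl i, Inr j} \<in> edges G'" using i j by (intro f(3)) (auto simp: EJ)
        then show "{w, v} \<in> edges G'" using i j by simp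
      qed
      let ?g = "g \<circ> inv_into {..<k} (\<lambda>i. f (Inl i))"
      have "bij_betw (\<lambda>i. f (Inl i)) {..<k} S'" using injl by (simp add: S'_def bij_betw_def)
      \<comment> \<open>The relabelling follows the copy of T, so every core edge of G is also an
        edge of the relabelled graph, not merely an edge of some isomorphic core.\<close>
      then have "bij_betw ?g S' S" using g by (intro bij_betw_trans[OF bij_betw_inv_into])
      then obtain \<psi> where \<psi>: "bij_betw \<psi> {..<n} {..<n}" "\<And>i. i \<in> S' \<Longrightarrow> \<psi> i = ?g i"
        using extend_bij[OF S(1) S'n] by (metis finite_lessThan)
      have \<psi>f: "\<psi> (f (Inl i)) = g i" if "i < k" for i
      proof -
        have "\<psi> (f (Inl i)) = ?g (f (Inl i))" using that by (intro \<psi>(2)) (auto simp: S'_def)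
        also have "\<dots> = g i" using inv_into_f_f[OF injl, of i] that by simp
        finally show ?thesis .
      qed
      have \<psi>S: "\<psi> ` S' = S" unfolding S'_def image_image gS[symmetric] using \<psi>f by auto
      have inj\<psi>: "inj_on \<psi> (verts G')" using \<psi>(1) V'(2) by (simp add: bij_betw_def)
      let ?G = "relabel \<psi> G'"
      have free'': "?G \<in> free_graphs n Fs" by (rule relabel_free[OF G' \<psi>(1)])
      then have V'': "fin_simple_graph ?G" "verts ?G = {..<n}" by (auto simp: free_graphs_def)
      have fj'': "fully_joined ?G S"
        using fully_joined_relabel[OF V'(1) inj\<psi> _ fj'] S'n V'(2) \<psi>S by simp
      have "adj_pairs G S \<subseteq> adj_pairs ?G S"
      proof
        fix p assume "p \<in> adj_pairs G S"
        then obtain i j where ij: "p = (g i, g j)" "i < k" "j < k" "{g i, g j} \<in> edges G"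
          unfolding gS[symmetric] by (auto simp: adj_pairs_def)
        then have "Inl ` {i, j} \<in> edges ?J" unfolding EJ by (intro UnI1 imageI) (simp add: T_def)
        then have "{f (Inl i), f (Inl j)} \<in> edges G'" using f(3) by fastforce
        then have "\<psi> ` {f (Inl i), f (Inl j)} \<in> edges ?G"
          unfolding relabel_def ugraph.simps by (rule imageI)
        then have "{g i, g j} \<in> edges ?G" using \<psi>f ij by simp
        then show "p \<in> adj_pairs ?G S" using ij gS by (auto simp: adj_pairs_def)
      qed
      \<comment> \<open>By maximality of the core pairs of G, inclusion is equality. The cores
        agree, which is the condition for comparing outer pairs.\<close>
      then have eq: "adj_pairs G S = adj_pairs ?G S"
        using core[OF free'' fj''] fS by (intro card_seteq finite_adj_pairs)
      have same: "\<forall>i\<in>S. \<forall>j\<in>S. {i, j} \<in> edges ?G \<longleftrightarrow> {i, j} \<in> edges G"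
      proof (intro ballI)
        fix i j assume "i \<in> S" "j \<in> S"
        then have "{i, j} \<in> edges X \<longleftrightarrow> (i, j) \<in> adj_pairs X S" for X by (simp add: adj_pairs_def)
        then show "{i, j} \<in> edges ?G \<longleftrightarrow> {i, j} \<in> edges G" using eq by simp
      qed
      have "card (adj_pairs ?G ({..<n} - S)) \<le> card (adj_pairs G ({..<n} - S))"
        by (rule outer[OF free'' fj'' same])
      then have "2 * real (card (edges ?G)) \<le> 2 * real (card (edges G))"
        unfolding card_edges_fully_joined[OF V'' S(1) fj''] card_edges_fully_joined[OF V S(1,3)] eq by simp
      then show ?thesis using card_edges_relabel[OF V'(1) inj\<psi>] by simp
    qed
    then have "G \<in> edge_extremal_containing ?J n Fs"
      using free cont by (simp add: edge_extremal_containing_def)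
    then show "G \<in> join_extremal n Fs"
      using T unfolding join_extremal_def indep_cover by (auto simp: Let_def)
  qed
qed

end

theorem theorem2p3:
  fixes s :: nat and F :: "nat ugraph"
  assumes "s \<ge> 1" and "fin_simple_graph F"
  shows "\<forall>\<^sub>F n in sequentially.
     (fam_indep_cover_num {matching_graph (s + 1), F} = enat (s + 1) \<longrightarrow>
        spectral_extremal n {matching_graph (s + 1), F}
          \<subseteq> edge_extremal n {matching_graph (s + 1), F}) \<and>
     (2 \<le> fam_indep_cover_num {matching_graph (s + 1), F} \<and>
      fam_indep_cover_num {matching_graph (s + 1), F} \<le> enat s \<longrightarrow>
        spectral_extremal n {matching_graph (s + 1), F}
          \<subseteq> join_extremal n {matching_graph (s + 1), F})"
proof -
  let ?Fs = "{matching_graph (s + 1), F}"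
  have fam: "forbidden_family ?Fs s k" if "k \<ge> 1" "fam_indep_cover_num ?Fs = enat (Suc k)" for k
    using that assms(2) matching_graph_simple by unfold_locales auto
  have 1: "\<forall>\<^sub>F n in sequentially. fam_indep_cover_num ?Fs = enat (s + 1) \<longrightarrow>
      spectral_extremal n ?Fs \<subseteq> edge_extremal n ?Fs"
  proof (cases "fam_indep_cover_num ?Fs = enat (s + 1)")
    case True
    then interpret forbidden_family ?Fs s s using assms(1) by (intro fam) auto
    show ?thesis using spectral_extremal_subset_edge_extremal[OF refl] by eventually_elim auto
  qed simp
  have 2: "\<forall>\<^sub>F n in sequentially.
      2 \<le> fam_indep_cover_num ?Fs \<and> fam_indep_cover_num ?Fs \<le> enat s \<longrightarrow>
      spectral_extremal n ?Fs \<subseteq> join_extremal n ?Fs"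
  proof (cases "2 \<le> fam_indep_cover_num ?Fs \<and> fam_indep_cover_num ?Fs \<le> enat s")
    case True
    then obtain b where b: "fam_indep_cover_num ?Fs = enat b" by (cases "fam_indep_cover_num ?Fs") auto
    \<comment> \<open>This secures a nonempty core, of size b - 1.\<close>
    have "2 \<le> b" using True unfolding b by (simp add: numeral_eq_enat)
    then interpret forbidden_family ?Fs s "b - 1" using b by (intro fam) auto
    show ?thesis using spectral_extremal_subset_join_extremal by eventually_elim auto
  qed auto
  show ?thesis using 1 2 by eventually_elim blast
qed

end
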